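(* Let $A=\bigcup_{k=1}^NA_k\subset\mathbb{R}^2$ be the multi-layer concentric disk with radii $r_1>r_2>\cdots>r_N>0$ and layer conductivities $\sigma_1,\dots,\sigma_N$ (see context), and let $H=\sum_{n=1}^{+\infty}a_nr^ne^{\mathrm{i}n\theta}$ in polar coordinates $(r,\theta)$ be the background potential, with constants $a_n$. Consider the conductivity problem $$\nabla\cdot(\sigma\nabla u)=0\ \text{ in }\mathbb{R}^2,\qquad u-H=\mathcal{O}(|x|^{-1})\ \text{ as }|x|\to\infty,$$ with $\sigma=\sigma_k$ in $A_k$, $k=0,\dots,N$, i.e. with the transmission conditions $u|_+=u|_-$ and $\sigma_{k-1}\frac{\partial u}{\partial\nu_k}|_+=\sigma_k\frac{\partial u}{\partial\nu_k}|_-$ on $\{|x|=r_k\}$, $k=1,\dots,N$. For $n\ge1$ let $\mathbb{M}_N^{(n)}$ be the $N\times N$ matrix ($n$-order generalized polarization matrix) with entries $$(\mathbb{M}_N^{(n)})_{ij}=\begin{cases}-2\lambda_i,& i=j,\\ (r_j/r_i)^{2n},& i<j,\\ -1,& i>j.\end{cases}$$ Then $\mathbb{M}_N^{(n)}$ is invertible, and the transmission problem is uniquely solvable with the solution given by $$u-H=\sum_{n=1}^{+\infty}a_ne^{\mathrm{i}n\theta}\Big(r^n\bm{e}_{1:l}^T+\frac1{r^n}\bm{e}_{l+1:N}^T\Big)\Upsilon^{(n)}_{N,l}\,(\mathbb{M}_N^{(n)})^{-1}\bm{e}\quad\text{in }A_l,\ l=0,1,\dots,N,$$ where $\Upsi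lon^{(n)}_{N,l}=\mathrm{diag}(\underbrace{1,\dots,1}_{l},r_{l+1}^{2n},\dots,r_N^{2n})$.
   Context: Multi-layer concentric disk: $A_0=\{|x|>r_1\}$, $A_k=\{r_{k+1}<|x|\le r_k\}$ for $k=1,\dots,N-1$, and $A_N=\{|x|\le r_N\}$. The conductivity is the constant $\sigma_k>0$ in $A_k$, with $\sigma_0=1$ and $\sigma_k\neq\sigma_{k-1}$ for $k=1,\dots,N$, and $$\lambda_k=\frac{\sigma_k+\sigma_{k-1}}{2(\sigma_k-\sigma_{k-1})},\quad k=1,\dots,N.$$ $\nu_k$ is the outward unit normal on $\{|x|=r_k\}$; $|_+$, $|_-$ denote limits from outside and inside. $H$ is a (complex-valued) harmonic function in $\mathbb{R}^2$, so the series for $H$ converges in all of $\mathbb{R}^2$. $\bm{e}_k$ is the $k$-th standard basis vector of $\mathbb{R}^N$, $\bm{e}=(1,1,\dots,1)^T\in\mathbb{R}^N$, and $\bm{e}_{i:j}=\sum_{k=i}^j\bm{e}_k$ for $i\le j$, $\bm{e}_{i:j}=0$ for $i>j$. *)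

theory Defs
  imports
    "HOL-Analysis.Analysis"
    "HOL-Library.Landau_Symbols"
    "Jordan_Normal_Form.Gauss_Jordan_Elimination"
begin

text \<open>The plane is identified with \<^typ>\<open>complex\<close>, regarded as a real vector space:
  the point with polar coordinates \<open>(\<rho>, \<theta>)\<close> is \<^term>\<open>rcis \<rho> \<theta>\<close>, and differentiability is
  always real (Frechet) differentiability.\<close>

definition dir_deriv :: "complex \<Rightarrow> (complex \<Rightarrow> complex) \<Rightarrow> complex \<Rightarrow> complex" where
  "dir_deriv v f z = frechet_derivative f (at z) v"

text \<open>The directions \<^term>\<open>1\<close> and \<^term>\<open>\<i>\<close> are the two coordinate directions, so these are the
  twice continuously differentiable functions on an open set.\<close>

definition C2_on :: "complex set \<Rightarrow> (complex \<Rightarrow> complex) \<Rightarrow> bool" where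
  "C2_on S f \<longleftrightarrow>
     (\<forall>z\<in>S. f differentiable (at z)) \<and>
     (\<forall>v\<in>{1, \<i>}. (\<forall>z\<in>S. dir_deriv v f differentiable (at z)) \<and>
        (\<forall>w\<in>{1, \<i>}. continuous_on S (dir_deriv w (dir_deriv v f))))"

definition div_coeff_grad :: "(complex \<Rightarrow> real) \<Rightarrow> (complex \<Rightarrow> complex) \<Rightarrow> complex \<Rightarrow> complex" where
  "div_coeff_grad c f z =
     dir_deriv 1 (\<lambda>w. c w *\<^sub>R dir_deriv 1 f w) z + dir_deriv \<i> (\<lambda>w. c w *\<^sub>R dir_deriv \<i> f w) z"

definition harmonic_on :: "complex set \<Rightarrow> (complex \<Rightarrow> complex) \<Rightarrow> bool" where
  "harmonic_on S f \<longleftrightarrow> C2_on S f \<and>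
     (\<forall>z\<in>S. dir_deriv 1 (dir_deriv 1 f) z + dir_deriv \<i> (dir_deriv \<i> f) z = 0)"

text \<open>Radii are \<open>r 1, \<dots>, r N\<close> and conductivities \<open>s 0, \<dots>, s N\<close>; all other values of
  \<open>r\<close> and \<open>s\<close> are irrelevant.\<close>

definition layer :: "nat \<Rightarrow> (nat \<Rightarrow> real) \<Rightarrow> nat \<Rightarrow> complex set" where
  "layer N r k =
     (if k = 0 then {x. cmod x > r 1}
      else if k < N then {x. r (k + 1) < cmod x \<and> cmod x \<le> r k}
      else {x. cmod x \<le> r N})"

definition conductivity :: "nat \<Rightarrow> (nat \<Rightarrow> real) \<Rightarrow> (nat \<Rightarrow> real) \<Rightarrow> complex \<Rightarrow> real" where
  "conductivity N r s x = s (THE k. k \<le> N \<and> x \<in> layer N r k)"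

definition lam :: "(nat \<Rightarrow> real) \<Rightarrow> nat \<Rightarrow> real" where
  "lam s k = (s k + s (k - 1)) / (2 * (s k - s (k - 1)))"

text \<open>The unit normal of a centred circle is \<open>x / |x|\<close>; this formula also extends it
  off the circle, where the one-sided limits are taken.\<close>

definition normal_deriv :: "(complex \<Rightarrow> complex) \<Rightarrow> complex \<Rightarrow> complex" where
  "normal_deriv u x = dir_deriv (x /\<^sub>R cmod x) u x"

text \<open>Traces on a circle of radius \<open>\<rho>\<close> from outside and from inside.\<close>

definition outer_limit :: "real \<Rightarrow> (complex \<Rightarrow> complex) \<Rightarrow> complex \<Rightarrow> complex \<Rightarrow> bool" where
  "outer_limit \<rho> f z l \<longleftrightarrow> (f \<longlongrightarrow> l) (at z within {x. cmod x > \<rho>})"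

definition inner_limit :: "real \<Rightarrow> (complex \<Rightarrow> complex) \<Rightarrow> complex \<Rightarrow> complex \<Rightarrow> bool" where
  "inner_limit \<rho> f z l \<longleftrightarrow> (f \<longlongrightarrow> l) (at z within {x. cmod x < \<rho>})"

text \<open>Classical solutions of the transmission problem. On each interface the common trace is
  required to be the value of \<open>u\<close> there; otherwise the values of \<open>u\<close> on the circles
  would be arbitrary and uniqueness could only hold off the circles.\<close>

definition transmission_solution ::
  "nat \<Rightarrow> (nat \<Rightarrow> real) \<Rightarrow> (nat \<Rightarrow> real) \<Rightarrow> (complex \<Rightarrow> complex) \<Rightarrow> (complex \<Rightarrow> complex) \<Rightarrow> bool" where
  "transmission_solution N r s H u \<longleftrightarrow>
     (\<forall>k\<le>N. C2_on (interior (layer N r k)) u \<and>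
        (\<forall>x\<in>interior (layer N r k). div_coeff_grad (conductivity N r s) u x = 0)) \<and>
     (\<forall>k\<in>{1..N}. \<forall>z. cmod z = r k \<longrightarrow>
        outer_limit (r k) u z (u z) \<and> inner_limit (r k) u z (u z) \<and>
        (\<exists>gp gm. outer_limit (r k) (normal_deriv u) z gp \<and>
                 inner_limit (r k) (normal_deriv u) z gm \<and>
                 s (k - 1) *\<^sub>R gp = s k *\<^sub>R gm)) \<and>
     (\<lambda>x. cmod (u x - H x)) \<in> O[at_infinity](\<lambda>x. 1 / cmod x)"

text \<open>Matrices and vectors of dimension \<open>N\<close> are indexed from \<open>0\<close> in the library, so index
  \<open>i\<close> below stands for the mathematical index \<open>i + 1\<close>.\<close>

definition gpm :: "nat \<Rightarrow> (nat \<Rightarrow> real) \<Rightarrow> (nat \<Rightarrow> real) \<Rightarrow> nat \<Rightarrow> real mat" where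
  "gpm N r s n = Matrix.mat N N (\<lambda>(i, j).
     if i = j then - 2 * lam s (i + 1)
     else if i < j then (r (j + 1) / r (i + 1)) ^ (2 * n)
     else - 1)"

text \<open>The sum of the standard basis vectors number \<open>i, \<dots>, j\<close> (counted from 1);
  the zero vector for \<open>i > j\<close>.\<close>

definition e_range :: "nat \<Rightarrow> nat \<Rightarrow> nat \<Rightarrow> real Matrix.vec" where
  "e_range N i j = finsum_vec TYPE(real) N (\<lambda>k. unit_vec N (k - 1)) {i..j}"

definition e_all :: "nat \<Rightarrow> real Matrix.vec" where
  "e_all N = Matrix.vec N (\<lambda>_. 1)"

definition Upsilon :: "nat \<Rightarrow> (nat \<Rightarrow> real) \<Rightarrow> nat \<Rightarrow> nat \<Rightarrow> real mat" where
  "Upsilon N r n l = mat_diag N (\<lambda>i. if i < l then 1 else r (i + 1) ^ (2 * n))"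

text \<open>The coefficient of \<open>a\<^sub>n e\<^sup>i\<^sup>n\<^sup>\<theta>\<close> in layer \<open>l\<close> at radius \<open>\<rho>\<close>. At \<open>\<rho> = 0\<close>, which only
  occurs for \<open>l = N\<close>, the singular term is absent because its vector is zero.
  \<^const>\<open>mat_inverse\<close> is option-valued, with value \<^const>\<open>None\<close> only on singular matrices.\<close>

definition layer_coeff ::
  "nat \<Rightarrow> (nat \<Rightarrow> real) \<Rightarrow> (nat \<Rightarrow> real) \<Rightarrow> nat \<Rightarrow> nat \<Rightarrow> real \<Rightarrow> real" where
  "layer_coeff N r s n l \<rho> =
     scalar_prod (\<rho> ^ n \<cdot>\<^sub>v e_range N 1 l + (1 / \<rho> ^ n) \<cdot>\<^sub>v e_range N (l + 1) N)
       (Upsilon N r n l *\<^sub>v (the (mat_inverse (gpm N r s n)) *\<^sub>v e_all N))"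

end

theory Submission
  imports Defs "Jordan_Normal_Form.Determinant" "HOL-Complex_Analysis.Cauchy_Integral_Formula"
begin

text \<open>For a vector \<open>x\<close> with \<open>M x = b e\<close> put \<open>P\<^sub>k = b + x\<^sub>1 + \<dots> + x\<^sub>k\<close> and
  \<open>Q\<^sub>k = \<Sum>\<^sub>i\<^sub>>\<^sub>k r\<^sub>i^(2n) x\<^sub>i\<close>. The rows of the system say exactly that the radial profile
  \<open>P\<^sub>k \<rho>^n + Q\<^sub>k / \<rho>^n\<close> and its flux match across the interfaces. The product of profile and flux,
  \<open>\<sigma>\<^sub>k n (P\<^sub>k\<^sup>2 \<rho>^(2n) - Q\<^sub>k\<^sup>2 / \<rho>^(2n))\<close>, is continuous and increasing in \<open>\<rho>\<close> and nonnegative in the core,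
  so \<open>|Q\<^sub>0| \<le> |b| r\<^sub>1^(2n)\<close>. For \<open>b = 0\<close> this makes the kernel of \<open>M\<close> trivial; for \<open>b = 1\<close> it bounds
  all \<open>P\<^sub>k\<close> and \<open>Q\<^sub>k\<close> exponentially in \<open>n\<close>. Since \<open>H\<close> is entire, the series then define the solution in
  layer \<open>k\<close> as \<open>f(z) + cnj (g(1/z))\<close> with entire \<open>f\<close>, \<open>g\<close>, and the interface conditions hold termwise.

  Uniqueness is a maximum principle: after adding a small multiple of a strictly subharmonic radial
  function whose flux jumps the right way, the difference of two solutions has no maximum
  inside a layer or on an interface, so it is dominated by its values on large circles.\<close>

section \<open>The polarization matrix\<close>

text \<open>\<open>R k\<close> stands for \<open>r k ^ (2 * n)\<close>. Multiplying the trace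
  condition by the flux condition shows that \<open>s k * (P^2 * R - Q^2 / R)\<close> is continuous
  across interfaces; within a layer it grows with \<open>R\<close>, and in the core it is
  nonnegative because \<open>Q N = 0\<close>.\<close>

lemma transmission_energy_bound:
  fixes N :: nat and R s P Q :: "nat \<Rightarrow> real"
  assumes N: "1 \<le> N"
    and R_pos: "\<And>k. 1 \<le> k \<Longrightarrow> k \<le> N \<Longrightarrow> 0 < R k"
    and R_decreasing: "\<And>k. 1 \<le> k \<Longrightarrow> k < N \<Longrightarrow> R (k + 1) \<le> R k"
    and s_pos: "\<And>k. k \<le> N \<Longrightarrow> 0 < s k"
    and cont: "\<And>k. 1 \<le> k \<Longrightarrow> k \<le> N \<Longrightarrow> P k * R k + Q k = P (k - 1) * R k + Q (k - 1)"
    and flux: "\<And>k. 1 \<le> k \<Longrightarrow> k \<le> N \<Longrightarrow>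
      s k * (P k * R k - Q k) = s (k - 1) * (P (k - 1) * R k - Q (k - 1))"
    and Q_N: "Q N = 0"
  shows "\<bar>Q 0\<bar> \<le> \<bar>P 0\<bar> * R 1"
proof -
  have transfer: "s k * ((P k)\<^sup>2 * R k - (Q k)\<^sup>2 / R k) =
      s (k - 1) * ((P (k - 1))\<^sup>2 * R k - (Q (k - 1))\<^sup>2 / R k)" if "1 \<le> k" "k \<le> N" for k
  proof -
    have *: "s j * ((P j)\<^sup>2 * R k - (Q j)\<^sup>2 / R k) = (P j * R k + Q j) * (s j * (P j * R k - Q j)) / R k" for j
      using R_pos[OF that] by (simp add: field_simps power2_eq_square)
    show ?thesis unfolding * using cont[OF that] flux[OF that] by simp
  qed
  have "0 \<le> s k * ((P k)\<^sup>2 * R k - (Q k)\<^sup>2 / R k)" if "1 \<le> k" "k \<le> N" for k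
    using that(2,1)
  proof (induction rule: inc_induct)
    case base
    then show ?case using Q_N s_pos[of N] R_pos[of N] by simp
  next
    case (step k)
    have k: "1 \<le> k" "k < N" using step by auto
    \<comment> \<open>First cross interface \<open>k + 1\<close> into layer \<open>k\<close>, then
      move outward through that layer.\<close>
    have "0 \<le> s k * ((P k)\<^sup>2 * R (Suc k) - (Q k)\<^sup>2 / R (Suc k))"
      using step.IH transfer[of "Suc k"] k by simp
    also have "\<dots> \<le> s k * ((P k)\<^sup>2 * R k - (Q k)\<^sup>2 / R k)"
      using R_decreasing[of k] R_pos[of k] R_pos[of "Suc k"] s_pos[of k] k
      by (intro mult_left_mono diff_mono divide_left_mono) auto
    finally show ?case .
  qed
  from this[of 1] have "0 \<le> s 0 * ((P 0)\<^sup>2 * R 1 - (Q 0)\<^sup>2 / R 1)"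
    using transfer[of 1] N by simp
  then have "(Q 0)\<^sup>2 \<le> (P 0 * R 1)\<^sup>2"
    using s_pos[of 0] R_pos[of 1] N
    by (simp add: zero_le_mult_iff field_simps power2_eq_square)
  then show ?thesis
    using R_pos[of 1] N by (metis abs_le_square_iff abs_mult abs_of_pos order.refl)
qed

section \<open>Sequences of at most geometric growth\<close>

text \<open>Multiplying the Taylor coefficients of an entire function without constant term by such
  a sequence leaves it entire; the layer potentials converge for this reason.\<close>

definition exp_bounded :: "(nat \<Rightarrow> real) \<Rightarrow> bool" where
  "exp_bounded f \<longleftrightarrow> (\<exists>C B. 0 \<le> C \<and> 0 \<le> B \<and> (\<forall>n\<ge>1. \<bar>f n\<bar> \<le> C * B ^ n))"

lemma exp_boundedI: "0 \<le> C \<Longrightarrow> 0 \<le> B \<Longrightarrow> (\<And>n. 1 \<le> n \<Longrightarrow> \<bar>f n\<bar> \<le> C * B ^ n) \<Longrightarrow> exp_bounded f"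
  unfolding exp_bounded_def by blast

lemma exp_bounded_const: "exp_bounded (\<lambda>n. c)"
  by (rule exp_boundedI[of "\<bar>c\<bar>" 1]) auto

lemma exp_bounded_power: "exp_bounded (\<lambda>n. c ^ (2 * n))"
  by (rule exp_boundedI[of 1 "c\<^sup>2"]) (auto simp: power_mult)

lemma exp_bounded_add:
  assumes "exp_bounded f" "exp_bounded g"
  shows "exp_bounded (\<lambda>n. f n + g n)"
proof -
  from assms obtain C B D E where *: "0 \<le> C" "0 \<le> B" "\<And>n. n \<ge> 1 \<Longrightarrow> \<bar>f n\<bar> \<le> C * B ^ n"
    "0 \<le> D" "0 \<le> E" "\<And>n. n \<ge> 1 \<Longrightarrow> \<bar>g n\<bar> \<le> D * E ^ n"
    unfolding exp_bounded_def by metis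
  show ?thesis
  proof (rule exp_boundedI[of "C + D" "max B E"])
    fix n :: nat assume n: "1 \<le> n"
    have "\<bar>f n + g n\<bar> \<le> C * B ^ n + D * E ^ n" using *(3,6)[OF n] by linarith
    also have "\<dots> \<le> C * max B E ^ n + D * max B E ^ n"
      using * by (intro add_mono mult_left_mono power_mono) auto
    finally show "\<bar>f n + g n\<bar> \<le> (C + D) * max B E ^ n" by (simp add: algebra_simps)
  qed (use * in auto)
qed

lemma exp_bounded_mult:
  assumes "exp_bounded f" "exp_bounded g"
  shows "exp_bounded (\<lambda>n. f n * g n)"
proof -
  from assms obtain C B D E where *: "0 \<le> C" "0 \<le> B" "\<And>n. n \<ge> 1 \<Longrightarrow> \<bar>f n\<bar> \<le> C * B ^ n"
    "0 \<le> D" "0 \<le> E" "\<And>n. n \<ge> 1 \<Longrightarrow> \<bar>g n\<bar> \<le> D * E ^ n"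
    unfolding exp_bounded_def by metis
  show ?thesis
  proof (rule exp_boundedI[of "C * D" "B * E"])
    fix n :: nat assume n: "1 \<le> n"
    have "\<bar>f n * g n\<bar> \<le> (C * B ^ n) * (D * E ^ n)" unfolding abs_mult
      using * n by (intro mult_mono) auto
    then show "\<bar>f n * g n\<bar> \<le> C * D * (B * E) ^ n" by (simp add: power_mult_distrib algebra_simps)
  qed (use * in auto)
qed

lemma exp_bounded_diff: "exp_bounded f \<Longrightarrow> exp_bounded g \<Longrightarrow> exp_bounded (\<lambda>n. f n - g n)"
  using exp_bounded_add[of f "\<lambda>n. (-1) * g n"] exp_bounded_mult[OF exp_bounded_const[of "-1"], of g] by simp

section \<open>The linear system as interface conditions for a single mode\<close>

locale concentric_disk =
  fixes N :: nat and r s :: "nat \<Rightarrow> real"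
  assumes N: "1 \<le> N"
    and r_decreasing: "\<And>k. 1 \<le> k \<Longrightarrow> k < N \<Longrightarrow> r (k + 1) < r k"
    and r_N_pos: "0 < r N"
    and s_pos: "\<And>k. k \<le> N \<Longrightarrow> 0 < s k"
    and s_neq: "\<And>k. 1 \<le> k \<Longrightarrow> k \<le> N \<Longrightarrow> s k \<noteq> s (k - 1)"
begin

lemma r_strict_antimono: "1 \<le> i \<Longrightarrow> i < j \<Longrightarrow> j \<le> N \<Longrightarrow> r j < r i"
proof (induction j)
  case (Suc j)
  show ?case
  proof (cases "i = j")
    case True
    then show ?thesis using r_decreasing[of j] Suc.prems by simp
  next
    case False
    then show ?thesis using Suc r_decreasing[of j] by fastforce
  qed
qed simp

lemma r_antimono: "1 \<le> i \<Longrightarrow> i \<le> j \<Longrightarrow> j \<le> N \<Longrightarrow> r j \<le> r i"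
  using r_strict_antimono[of i j] by (cases "i = j") auto

lemma r_pos: "1 \<le> k \<Longrightarrow> k \<le> N \<Longrightarrow> 0 < r k"
  using r_antimono[of k N] r_N_pos by linarith

text \<open>In layer \<open>k\<close> the radial factor of the \<open>n\<close>-th mode is \<open>regular k * \<rho>^n + singular k / \<rho>^n\<close>;
  \<open>b\<close> is the amplitude of the background mode.\<close>

definition regular :: "real \<Rightarrow> real vec \<Rightarrow> nat \<Rightarrow> real" where
  "regular b x k = b + (\<Sum>i<k. vec_index x i)"

definition singular :: "nat \<Rightarrow> real vec \<Rightarrow> nat \<Rightarrow> real" where
  "singular n x k = (\<Sum>i\<in>{k..<N}. r (i + 1) ^ (2 * n) * vec_index x i)"

lemma singular_N [simp]: "singular n x N = 0"
  by (simp add: singular_def)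

lemma regular_0 [simp]: "regular b x 0 = b"
  by (simp add: regular_def)

lemma regular_Suc: "regular b x (Suc k) = regular b x k + vec_index x k"
  by (simp add: regular_def)

lemma singular_Suc: "k < N \<Longrightarrow> singular n x (Suc k) = singular n x k - r (Suc k) ^ (2 * n) * vec_index x k"
  by (simp add: singular_def sum.atLeast_Suc_lessThan)

lemma gpm_carrier [simp]: "gpm N r s n \<in> carrier_mat N N"
  by (simp add: gpm_def)

text \<open>The row is split at the diagonal: the entries -1 on the left give minus a partial sum,
  which is \<open>regular\<close> with amplitude 0, and the radius ratios on the right give the tail
  \<open>singular\<close> divided by the power of the radius of this row.\<close>

lemma gpm_mult_vec_index:
  assumes x: "x \<in> carrier_vec N" and k: "k < N"
  shows "vec_index (gpm N r s n *\<^sub>v x) k =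
    singular n x (Suc k) / r (Suc k) ^ (2 * n) - regular 0 x k - 2 * lam s (Suc k) * vec_index x k"
proof -
  have "vec_index (gpm N r s n *\<^sub>v x) k = (\<Sum>i\<in>{0..<N}. gpm N r s n $$ (k, i) * vec_index x i)"
    using x k by (simp add: gpm_def scalar_prod_def)
  also have "{0..<N} = {..<k} \<union> {k} \<union> {Suc k..<N}" using k by auto
  also have "(\<Sum>i\<in>{..<k} \<union> {k} \<union> {Suc k..<N}. gpm N r s n $$ (k, i) * vec_index x i) =
     (\<Sum>i<k. gpm N r s n $$ (k, i) * vec_index x i) + gpm N r s n $$ (k, k) * vec_index x k
     + (\<Sum>i\<in>{Suc k..<N}. gpm N r s n $$ (k, i) * vec_index x i)"
    by (subst sum.union_disjoint, auto)+
  also have "(\<Sum>i<k. gpm N r s n $$ (k, i) * vec_index x i) = - regular 0 x k"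
    unfolding regular_def using k by (simp add: gpm_def sum_negf)
  also have "(\<Sum>i\<in>{Suc k..<N}. gpm N r s n $$ (k, i) * vec_index x i) =
      singular n x (Suc k) / r (Suc k) ^ (2 * n)"
    unfolding singular_def sum_divide_distrib using k
    by (intro sum.cong refl) (simp add: gpm_def power_divide)
  also have "gpm N r s n $$ (k, k) = - 2 * lam s (Suc k)" using k by (simp add: gpm_def)
  finally show ?thesis by simp
qed

text \<open>With \<open>lam\<close> written out, the row determines component \<open>k\<close> from
  the data of layer \<open>k\<close> alone. Flux matching, the triviality of the kernel and the
  growth bounds all come from this recursion.\<close>

lemma gpm_row_step:
  assumes x: "x \<in> carrier_vec N" and k: "k < N"
    and row: "vec_index (gpm N r s n *\<^sub>v x) k = b"
  shows "2 * s (Suc k) * vec_index x k =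
    (s k - s (Suc k)) * (regular b x k - singular n x k / r (Suc k) ^ (2 * n))"
proof -
  have R: "r (Suc k) ^ (2 * n) > 0" using r_pos[of "Suc k"] k by simp
  define d where "d = s k - s (Suc k)"
  have d: "d \<noteq> 0" using s_neq[of "Suc k"] k by (simp add: d_def)
  have lam: "2 * lam s (Suc k) = - (s (Suc k) + s k) / d"
    using d unfolding lam_def d_def by (simp add: field_simps)
  have reg: "regular b x k = b + regular 0 x k" by (simp add: regular_def)
  have "singular n x (Suc k) / r (Suc k) ^ (2 * n) = singular n x k / r (Suc k) ^ (2 * n) - vec_index x k"
    using k R by (simp add: singular_Suc diff_divide_distrib less_imp_neq[symmetric] del: power_eq_0_iff)
  with row have "2 * lam s (Suc k) * vec_index x k =
      singular n x k / r (Suc k) ^ (2 * n) - vec_index x k - regular b x k"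
    unfolding reg gpm_mult_vec_index[OF x k] by linarith
  then have "(s (Suc k) + s k) * vec_index x k =
      d * (regular b x k - singular n x k / r (Suc k) ^ (2 * n) + vec_index x k)"
    unfolding lam using d by (simp add: field_simps)
  then show ?thesis by (simp add: d_def algebra_simps)
qed

context
  fixes n :: nat and x :: "real vec" and b :: real
  assumes x: "x \<in> carrier_vec N"
    and rows: "\<And>k. k < N \<Longrightarrow> vec_index (gpm N r s n *\<^sub>v x) k = b"
begin

text \<open>Going inward, the component \<open>vec_index x k\<close> leaves the singular part, where
  it carries the factor \<open>r (Suc k) ^ (2 * n)\<close>, and joins the regular part; on the
  circle the two contributions are equal.\<close>

lemma trace_match:
  "k < N \<Longrightarrow> regular b x (Suc k) * r (Suc k) ^ (2 * n) + singular n x (Suc k) =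
    regular b x k * r (Suc k) ^ (2 * n) + singular n x k"
  by (simp add: regular_Suc singular_Suc algebra_simps)

text \<open>The difference regular minus singular grows by twice the transferred component times the
  power of the radius, so the flux condition is \<open>gpm_row_step\<close> multiplied by that
  power.\<close>

lemma flux_match:
  assumes k: "k < N"
  shows "s (Suc k) * (regular b x (Suc k) * r (Suc k) ^ (2 * n) - singular n x (Suc k)) =
    s k * (regular b x k * r (Suc k) ^ (2 * n) - singular n x k)"
proof -
  let ?R = "r (Suc k) ^ (2 * n)"
  have "2 * s (Suc k) * vec_index x k * ?R = (s k - s (Suc k)) * (regular b x k * ?R - singular n x k)"
    unfolding gpm_row_step[OF x k rows[OF k]]
    using r_pos[of "Suc k"] k by (simp add: field_simps)
  then show ?thesis
    using k by (simp add: regular_Suc singular_Suc algebra_simps)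
qed

lemma singular_0_bound: "\<bar>singular n x 0\<bar> \<le> \<bar>b\<bar> * r 1 ^ (2 * n)"
proof -
  have "\<bar>singular n x 0\<bar> \<le> \<bar>regular b x 0\<bar> * r 1 ^ (2 * n)"
  proof (rule transmission_energy_bound[where N = N and s = s])
    fix k assume k: "1 \<le> k" "k \<le> N"
    then show "regular b x k * r k ^ (2 * n) + singular n x k =
        regular b x (k - 1) * r k ^ (2 * n) + singular n x (k - 1)"
      using trace_match[of "k - 1"] by simp
    show "s k * (regular b x k * r k ^ (2 * n) - singular n x k) =
        s (k - 1) * (regular b x (k - 1) * r k ^ (2 * n) - singular n x (k - 1))"
      using k flux_match[of "k - 1"] by simp
  qed (use N r_pos r_decreasing s_pos in \<open>auto intro!: power_mono simp: less_imp_le\<close>)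
  then show ?thesis by simp
qed

end

text \<open>For amplitude 0 the energy bound makes all data outside the disk vanish; the row
  recursion then carries the zeros inward, one component per interface.\<close>

lemma gpm_kernel:
  assumes x: "x \<in> carrier_vec N" and ker: "gpm N r s n *\<^sub>v x = 0\<^sub>v N"
  shows "x = 0\<^sub>v N"
proof -
  have rows: "\<And>k. k < N \<Longrightarrow> vec_index (gpm N r s n *\<^sub>v x) k = 0" using ker by simp
  have "regular 0 x k = 0 \<and> singular n x k = 0 \<and> (\<forall>i<k. vec_index x i = 0)" if "k \<le> N" for k
    using that
  proof (induction k)
    case 0
    then show ?case using singular_0_bound[OF x rows] by simp
  next
    case (Suc k)
    then have "vec_index x k = 0"
      using gpm_row_step[OF x _ rows, of k] s_pos[of "Suc k"] by simp
    then show ?case using Suc by (auto simp: regular_Suc singular_Suc less_Suc_eq)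
  qed
  then show ?thesis using x by (intro eq_vecI) auto
qed

text \<open>A trivial kernel gives a nonzero determinant, so \<open>mat_inverse\<close> returns
  \<open>Some\<close> and \<open>the\<close> in \<open>layer_coeff\<close> yields a genuine
  inverse.\<close>

lemma gpm_inverse:
  obtains B where "mat_inverse (gpm N r s n) = Some B" "B \<in> carrier_mat N N"
    "gpm N r s n * B = 1\<^sub>m N" "B * gpm N r s n = 1\<^sub>m N"
proof -
  have "det (gpm N r s n) \<noteq> 0"
    using det_0_iff_vec_prod_zero_field[OF gpm_carrier] gpm_kernel by blast
  then have "gpm N r s n \<in> Units (ring_mat TYPE(real) N ())"
    by (rule det_non_zero_imp_unit[OF gpm_carrier])
  then obtain B where "mat_inverse (gpm N r s n) = Some B"
    using mat_inverse(1)[OF gpm_carrier] by fastforce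
  with mat_inverse(2)[OF gpm_carrier this] that show ?thesis by blast
qed

lemma invertible_gpm: "invertible_mat (gpm N r s n)"
proof -
  obtain B where "B \<in> carrier_mat N N" "gpm N r s n * B = 1\<^sub>m N" "B * gpm N r s n = 1\<^sub>m N"
    using gpm_inverse[of n] by metis
  then show ?thesis
    unfolding invertible_mat_def inverts_mat_def using gpm_carrier[of n] by (metis carrier_matD square_mat.simps)
qed

section \<open>Mode coefficients of the solution and their growth\<close>

definition weights :: "nat \<Rightarrow> real vec" where
  "weights n = the (mat_inverse (gpm N r s n)) *\<^sub>v e_all N"

lemma weights_carrier [simp]: "weights n \<in> carrier_vec N"
  by (rule gpm_inverse[of n]) (simp add: weights_def e_all_def)

lemma gpm_weights: "k < N \<Longrightarrow> vec_index (gpm N r s n *\<^sub>v weights n) k = 1"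
proof -
  assume k: "k < N"
  obtain B where B: "mat_inverse (gpm N r s n) = Some B" "B \<in> carrier_mat N N"
    "gpm N r s n * B = 1\<^sub>m N"
    using gpm_inverse[of n] by metis
  have e: "e_all N \<in> carrier_vec N" by (simp add: e_all_def)
  have "gpm N r s n *\<^sub>v weights n = (gpm N r s n * B) *\<^sub>v e_all N"
    unfolding weights_def B(1) option.sel by (rule assoc_mult_mat_vec[OF gpm_carrier B(2) e, symmetric])
  also have "\<dots> = e_all N" unfolding B(3) using e by simp
  finally show ?thesis using k by (simp add: e_all_def)
qed

abbreviation P :: "nat \<Rightarrow> nat \<Rightarrow> real" where "P k n \<equiv> regular 1 (weights n) k"
abbreviation Q :: "nat \<Rightarrow> nat \<Rightarrow> real" where "Q k n \<equiv> singular n (weights n) k"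

text \<open>Induction from the outside inward. The energy bound supplies \<open>Q 0\<close>, and
  each further component is a combination of \<open>P k\<close> and \<open>Q k\<close> with
  geometric factors, by \<open>gpm_row_step\<close>.\<close>

lemma exp_bounded_modes: "k \<le> N \<Longrightarrow> exp_bounded (P k) \<and> exp_bounded (Q k)"
proof (induction k)
  case 0
  have "exp_bounded (Q 0)"
    using singular_0_bound[OF weights_carrier gpm_weights]
    by (intro exp_boundedI[of 1 "(r 1)\<^sup>2"]) (auto simp: power_mult)
  then show ?case by (simp add: exp_bounded_const)
next
  case (Suc k)
  define c where "c = (s k - s (Suc k)) / (2 * s (Suc k))"
  have w: "vec_index (weights n) k = c * (P k n - Q k n * (1 / r (Suc k)) ^ (2 * n))" for n
    using gpm_row_step[OF weights_carrier _ gpm_weights, of k n] Suc.prems s_pos[of "Suc k"]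
    by (simp add: c_def field_simps)
  have "exp_bounded (\<lambda>n. vec_index (weights n) k)"
    unfolding w using Suc
    by (intro exp_bounded_mult exp_bounded_diff exp_bounded_const exp_bounded_power) auto
  then show ?case
    using Suc by (auto simp: regular_Suc singular_Suc
        intro!: exp_bounded_add exp_bounded_diff exp_bounded_mult exp_bounded_power)
qed

text \<open>The first vector selects components \<open>1\<close> to \<open>l\<close>, whose sum is
  \<open>P l n\<close> without the background amplitude 1; the second selects the remaining ones, to
  which \<open>Upsilon\<close> attaches exactly the powers in \<open>Q l n\<close>.\<close>

lemma layer_coeff_eq:
  assumes l: "l \<le> N"
  shows "layer_coeff N r s n l \<rho> = \<rho> ^ n * (P l n - 1) + Q l n / \<rho> ^ n"
proof -
  have e1: "vec_index (e_range N 1 l) i = (if i < l then 1 else 0)" if "i < N" for i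
  proof -
    have "vec_index (e_range N 1 l) i = (\<Sum>k\<in>{1..l}. vec_index (unit_vec N (k - 1)) i)"
      unfolding e_range_def using that by (subst index_finsum_vec) auto
    also have "\<dots> = (\<Sum>k\<in>{1..l}. if k = i + 1 then 1 else 0)"
      using that l by (intro sum.cong) auto
    finally show ?thesis by auto
  qed
  have e2: "vec_index (e_range N (l + 1) N) i = (if i < l then 0 else 1)" if "i < N" for i
  proof -
    have "vec_index (e_range N (l + 1) N) i = (\<Sum>k\<in>{l + 1..N}. vec_index (unit_vec N (k - 1)) i)"
      unfolding e_range_def using that by (subst index_finsum_vec) auto
    also have "\<dots> = (\<Sum>k\<in>{l + 1..N}. if k = i + 1 then 1 else 0)"
      using that l by (intro sum.cong) auto
    finally show ?thesis using that by auto
  qed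
  have dims: "e_range N i j \<in> carrier_vec N" for i j
    unfolding e_range_def by (rule finsum_vec_closed) auto
  have dim: "dim_vec (weights n) = N" by (rule carrier_vecD) simp
  have "vec_index (Upsilon N r n l *\<^sub>v weights n) i =
      (if i < l then 1 else r (i + 1) ^ (2 * n)) * vec_index (weights n) i" if "i < N" for i
  proof -
    have "vec_index (Upsilon N r n l *\<^sub>v weights n) i =
       (\<Sum>j\<in>{0..<N}. if j = i then (if i < l then 1 else r (i + 1) ^ (2 * n)) * vec_index (weights n) i else 0)"
      using that
      by (auto simp: Upsilon_def mat_diag_def scalar_prod_def dim simp del: sum.delta sum.delta' intro!: sum.cong)
    then show ?thesis using that by simp
  qed
  then have "layer_coeff N r s n l \<rho> = (\<Sum>i\<in>{0..<N}. (\<rho> ^ n * (if i < l then 1 else 0) + (1 / \<rho> ^ n) * (if i < l then 0 else 1)) *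
      ((if i < l then 1 else r (i + 1) ^ (2 * n)) * vec_index (weights n) i))"
    unfolding layer_coeff_def weights_def[symmetric] scalar_prod_def
    using e1 e2 carrier_vecD[OF dims]
    by (intro sum.cong) (auto simp: Upsilon_def mat_diag_def)
  also have "{0..<N} = {..<l} \<union> {l..<N}" using l by auto
  also have "(\<Sum>i\<in>{..<l} \<union> {l..<N}. (\<rho> ^ n * (if i < l then 1 else 0) + (1 / \<rho> ^ n) * (if i < l then 0 else 1)) *
      ((if i < l then 1 else r (i + 1) ^ (2 * n)) * vec_index (weights n) i))
     = (\<Sum>i<l. \<rho> ^ n * vec_index (weights n) i) + (\<Sum>i\<in>{l..<N}. (1 / \<rho> ^ n) * (r (i + 1) ^ (2 * n) * vec_index (weights n) i))"
    by (subst sum.union_disjoint) (auto intro!: arg_cong2[of _ _ _ _ "(+)"] sum.cong)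
  finally show ?thesis
    unfolding regular_def singular_def sum_distrib_left[symmetric] by simp
qed

end

section \<open>Uniqueness by a maximum principle\<close>

text \<open>Since \<open>g' 0 = 0\<close>, a positive \<open>L\<close> would make \<open>g'\<close>
  positive just to the right of 0 and \<open>g\<close> strictly increasing there.\<close>

lemma second_derivative_at_local_max:
  fixes g g' :: "real \<Rightarrow> real"
  assumes d: "0 < d"
    and der: "\<And>t. \<bar>t\<bar> < d \<Longrightarrow> (g has_real_derivative g' t) (at t)"
    and der2: "(g' has_real_derivative L) (at 0)"
    and max: "\<And>t. \<bar>t\<bar> < d \<Longrightarrow> g t \<le> g 0"
  shows "L \<le> 0"
proof (rule ccontr)
  assume "\<not> L \<le> 0"
  then have L: "0 < L" by simp
  have g'0: "g' 0 = 0"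
    using DERIV_local_max[OF der[of 0] d] d max by simp
  obtain e where e: "e > 0" "\<And>h. 0 < h \<Longrightarrow> h < e \<Longrightarrow> g' 0 < g' (0 + h)"
    using DERIV_pos_inc_right[OF der2 L] by blast
  define c where "c = min (d / 2) (e / 2)"
  have c: "0 < c" "c < d" "c < e" using d e by (auto simp: c_def)
  have "g 0 < g c"
  proof (rule DERIV_pos_imp_increasing_open[OF c(1)])
    fix t assume t: "0 < t" "t < c"
    show "\<exists>y. DERIV g t :> y \<and> 0 < y"
      using der[of t] e(2)[of t] t c g'0 by auto
  next
    show "continuous_on {0..c} g"
      using c by (intro DERIV_continuous_on[of _ g g'] has_field_derivative_at_within[OF der]) auto
  qed
  with max[of c] c show False by auto
qed

text \<open>Uses only the limit of the derivative at \<open>p\<close>, since on an interface only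
  one-sided limits of the normal derivative are given. A positive limit would make \<open>h\<close>
  increase to the right of \<open>p\<close>.\<close>

lemma right_derivative_limit_at_max:
  fixes h h' :: "real \<Rightarrow> real"
  assumes d: "0 < d"
    and der: "\<And>t. p < t \<Longrightarrow> t < p + d \<Longrightarrow> (h has_real_derivative h' t) (at t)"
    and cont: "(h \<longlongrightarrow> h p) (at_right p)"
    and lim: "(h' \<longlongrightarrow> L) (at_right p)"
    and max: "\<And>t. p < t \<Longrightarrow> t < p + d \<Longrightarrow> h t \<le> h p"
  shows "L \<le> 0"
proof (rule ccontr)
  assume "\<not> L \<le> 0"
  then have "eventually (\<lambda>t. 0 < h' t) (at_right p)"
    using order_tendstoD(1)[OF lim] by simp
  then obtain b where b: "b > p" "\<And>t. p < t \<Longrightarrow> t < b \<Longrightarrow> 0 < h' t"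
    unfolding eventually_at_right_field by blast
  define c where "c = (p + min b (p + d)) / 2"
  have c: "p < c" "c < b" "c < p + d" using d b by (auto simp: c_def min_def)
  have "h p < h c"
  proof (rule DERIV_pos_imp_increasing_open[OF c(1)])
    fix t assume t: "p < t" "t < c"
    show "\<exists>y. DERIV h t :> y \<and> 0 < y"
      using der[of t] b(2)[of t] t c by auto
  next
    show "continuous_on {p..c} h"
      unfolding continuous_on_def
    proof
      fix t assume t: "t \<in> {p..c}"
      show "(h \<longlongrightarrow> h t) (at t within {p..c})"
      proof (cases "t = p")
        case True
        then show ?thesis using cont c(1) by (simp add: at_within_Icc_at_right)
      next
        case False
        then have "isCont h t" using t c by (intro DERIV_isCont[OF der]) auto
        then show ?thesis
          using continuous_at_imp_continuous_at_within continuous_within by blast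
      qed
    qed
  qed
  with max[of c] c show False by auto
qed

text \<open>Reflection \<open>t\<close> to \<open>- t\<close> of the right-sided test.\<close>

lemma left_derivative_limit_at_max:
  fixes h h' :: "real \<Rightarrow> real"
  assumes d: "0 < d"
    and der: "\<And>t. p - d < t \<Longrightarrow> t < p \<Longrightarrow> (h has_real_derivative h' t) (at t)"
    and cont: "(h \<longlongrightarrow> h p) (at_left p)"
    and lim: "(h' \<longlongrightarrow> L) (at_left p)"
    and max: "\<And>t. p - d < t \<Longrightarrow> t < p \<Longrightarrow> h t \<le> h p"
  shows "0 \<le> L"
proof -
  have "- L \<le> 0"
  proof (rule right_derivative_limit_at_max[where h = "\<lambda>t. h (- t)" and h' = "\<lambda>t. - h' (- t)" and p = "- p", OF d])
    fix t assume t: "- p < t" "t < - p + d"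
    have "(h has_real_derivative h' (- t)) (at (- t))" using t by (intro der) auto
    then show "((\<lambda>t. h (- t)) has_real_derivative - h' (- t)) (at t)"
      by (simp add: DERIV_mirror)
    show "h (- t) \<le> h (- (- p))" using t max[of "- t"] by simp
  next
    show "((\<lambda>t. h (- t)) \<longlongrightarrow> h (- (- p))) (at_right (- p))"
      using cont by (simp add: filterlim_at_left_to_right[of _ _ p])
    show "((\<lambda>t. - h' (- t)) \<longlongrightarrow> - L) (at_right (- p))"
      using lim by (intro tendsto_minus) (simp add: filterlim_at_left_to_right[of _ _ p])
  qed
  then show ?thesis by simp
qed

section \<open>Limits along rays and continuity across a circle\<close>

text \<open>Turns traces on a circle into one-sided limits of one real variable along the ray
  through \<open>z\<close>, where the derivative tests apply.\<close>

lemma filterlim_ray_outer: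
  assumes z: "cmod z = \<rho>" and \<rho>: "0 < \<rho>"
  shows "filterlim (\<lambda>t. t *\<^sub>R (z /\<^sub>R \<rho>)) (at z within {x. \<rho> < cmod x}) (at_right \<rho>)"
  unfolding filterlim_at
proof
  have *: "cmod (t *\<^sub>R (z /\<^sub>R \<rho>)) = \<bar>t\<bar>" for t using z \<rho> by (simp add: abs_mult)
  show "eventually (\<lambda>t. t *\<^sub>R (z /\<^sub>R \<rho>) \<in> {x. \<rho> < cmod x} \<and> t *\<^sub>R (z /\<^sub>R \<rho>) \<noteq> z) (at_right \<rho>)"
    using eventually_at_right_less[of \<rho>]
  proof eventually_elim
    case (elim t)
    then have "\<rho> < cmod (t *\<^sub>R (z /\<^sub>R \<rho>))" unfolding * using \<rho> by simp
    with z show ?case by (metis mem_Collect_eq less_irrefl)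
  qed
  have "((\<lambda>t. t *\<^sub>R (z /\<^sub>R \<rho>)) \<longlongrightarrow> \<rho> *\<^sub>R (z /\<^sub>R \<rho>)) (at_right \<rho>)"
    by (intro tendsto_intros)
  then show "((\<lambda>t. t *\<^sub>R (z /\<^sub>R \<rho>)) \<longlongrightarrow> z) (at_right \<rho>)" using \<rho> by simp
qed

lemma filterlim_ray_inner:
  assumes z: "cmod z = \<rho>" and \<rho>: "0 < \<rho>"
  shows "filterlim (\<lambda>t. t *\<^sub>R (z /\<^sub>R \<rho>)) (at z within {x. cmod x < \<rho>}) (at_left \<rho>)"
  unfolding filterlim_at
proof
  have *: "cmod (t *\<^sub>R (z /\<^sub>R \<rho>)) = \<bar>t\<bar>" for t using z \<rho> by (simp add: abs_mult)
  show "eventually (\<lambda>t. t *\<^sub>R (z /\<^sub>R \<rho>) \<in> {x. cmod x < \<rho>} \<and> t *\<^sub>R (z /\<^sub>R \<rho>) \<noteq> z) (at_left \<rho>)"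
    using eventually_at_leftI[of 0 \<rho> "\<lambda>t. 0 < t \<and> t < \<rho>", OF _ \<rho>, simplified]
  proof eventually_elim
    case (elim t)
    then have "cmod (t *\<^sub>R (z /\<^sub>R \<rho>)) < \<rho>" unfolding * by simp
    with z show ?case by (metis mem_Collect_eq less_irrefl)
  qed
  have "((\<lambda>t. t *\<^sub>R (z /\<^sub>R \<rho>)) \<longlongrightarrow> \<rho> *\<^sub>R (z /\<^sub>R \<rho>)) (at_left \<rho>)"
    by (intro tendsto_intros)
  then show "((\<lambda>t. t *\<^sub>R (z /\<^sub>R \<rho>)) \<longlongrightarrow> z) (at_left \<rho>)" using \<rho> by simp
qed

text \<open>The two traces at \<open>z\<close> control \<open>u\<close> only off the circle. A
  nearby point of the circle is handled by its own outer trace: its value is a limit of exterior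
  values, which are already close to \<open>u z\<close>.\<close>

lemma isCont_of_traces:
  assumes \<rho>: "0 < \<rho>" and z: "cmod z = \<rho>"
    and outer: "\<And>x. cmod x = \<rho> \<Longrightarrow> outer_limit \<rho> u x (u x)"
    and inner: "inner_limit \<rho> u z (u z)"
  shows "isCont u z"
  unfolding isCont_def tendsto_iff
proof (intro allI impI)
  fix e :: real assume e: "0 < e"
  \<comment> \<open>Half of \<open>e\<close> leaves room for the non-strict inequality that survives
    the passage to circle points.\<close>
  have "eventually (\<lambda>x. dist (u x) (u z) < e / 2) (at z within {x. \<rho> < cmod x})"
    using outer[OF z] half_gt_zero[OF e] unfolding outer_limit_def tendsto_iff by blast
  then obtain d1 where d1: "d1 > 0"
    "\<And>x. \<rho> < cmod x \<Longrightarrow> x \<noteq> z \<Longrightarrow> dist x z < d1 \<Longrightarrow> dist (u x) (u z) < e / 2"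
    unfolding eventually_at by auto
  have "eventually (\<lambda>x. dist (u x) (u z) < e) (at z within {x. cmod x < \<rho>})"
    using inner e unfolding inner_limit_def tendsto_iff by blast
  then obtain d2 where d2: "d2 > 0"
    "\<And>x. cmod x < \<rho> \<Longrightarrow> x \<noteq> z \<Longrightarrow> dist x z < d2 \<Longrightarrow> dist (u x) (u z) < e"
    unfolding eventually_at by auto
  have on_circle: "dist (u y) (u z) < e" if y: "cmod y = \<rho>" "dist y z < d1" for y
  proof -
    let ?F = "at y within {x. \<rho> < cmod x}"
    have nt: "?F \<noteq> bot"
    proof
      assume "?F = bot"
      then have "eventually (\<lambda>x. False) (at_right \<rho>)"
        using eventually_compose_filterlim[OF _ filterlim_ray_outer[OF y(1) \<rho>], of "\<lambda>x. False"] by simp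
      then show False by simp
    qed
    have "eventually (\<lambda>x. x \<in> ball z d1) ?F"
      using y(2) by (intro topological_tendstoD[OF tendsto_ident_at]) (auto simp: dist_commute)
    moreover have "eventually (\<lambda>x. \<rho> < cmod x) ?F"
      by (simp add: eventually_at_filter)
    ultimately have "eventually (\<lambda>x. u x \<in> cball (u z) (e / 2)) ?F"
    proof eventually_elim
      case (elim x)
      then have "dist (u x) (u z) < e / 2"
        using d1(2)[of x] z by (metis dist_commute less_irrefl mem_ball)
      then show ?case by (simp add: dist_commute)
    qed
    then have "u y \<in> cball (u z) (e / 2)"
      using outer[OF y(1)] nt unfolding outer_limit_def
      by (metis Lim_in_closed_set closed_cball)
    then have "dist (u y) (u z) \<le> e / 2" by (simp add: dist_commute)
    then show ?thesis using e by linarith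
  qed
  show "eventually (\<lambda>x. dist (u x) (u z) < e) (at z)"
    unfolding eventually_at
  proof (intro exI[of _ "min d1 d2"] conjI ballI impI)
    fix x assume x: "x \<noteq> z \<and> dist x z < min d1 d2"
    consider "cmod x < \<rho>" | "cmod x = \<rho>" | "\<rho> < cmod x" by linarith
    then show "dist (u x) (u z) < e"
    proof cases
      case 1
      with x d2(2) show ?thesis by simp
    next
      case 2
      with x on_circle show ?thesis by simp
    next
      case 3
      with x d1(2)[of x] e show ?thesis by simp
    qed
  qed (use d1 d2 in auto)
qed

lemma open_norm_less: "open {x :: complex. cmod x < c}"
  by (intro open_Collect_less continuous_intros)

lemma open_norm_greater: "open {x :: complex. c < cmod x}"
  by (intro open_Collect_less continuous_intros)

lemma dir_deriv_eq: "(f has_derivative D) (at z) \<Longrightarrow> dir_deriv v f z = D v"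
  unfolding dir_deriv_def by (drule frechet_derivative_at) simp

text \<open>\<open>frechet_derivative\<close> is a choice among all derivatives, so functions with
  the same derivatives at \<open>z\<close> get the same value, differentiable or not.\<close>

lemma dir_deriv_cong_open:
  assumes "open S" "z \<in> S" "\<And>x. x \<in> S \<Longrightarrow> f x = g x"
  shows "dir_deriv v f z = dir_deriv v g z"
proof -
  have "(f has_derivative D) (at z) \<longleftrightarrow> (g has_derivative D) (at z)" for D
    by (rule iffI; erule has_derivative_transform_within_open[OF _ assms(1,2)]) (simp_all add: assms(3))
  then show ?thesis by (simp add: dir_deriv_def frechet_derivative_def)
qed

lemma has_vector_derivative_line:
  assumes "f differentiable (at (z + t *\<^sub>R v))"
  shows "((\<lambda>t. f (z + t *\<^sub>R v)) has_vector_derivative dir_deriv v f (z + t *\<^sub>R v)) (at t)"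
proof -
  have "((\<lambda>t. z + t *\<^sub>R v) has_vector_derivative v) (at t)"
    by (auto intro!: derivative_eq_intros)
  moreover have "(f has_derivative frechet_derivative f (at (z + t *\<^sub>R v))) (at (z + t *\<^sub>R v) within range (\<lambda>t. z + t *\<^sub>R v))"
    by (rule has_derivative_at_withinI[OF assms[unfolded frechet_derivative_works]])
  ultimately have "(f \<circ> (\<lambda>t. z + t *\<^sub>R v) has_vector_derivative dir_deriv v f (z + t *\<^sub>R v)) (at t)"
    unfolding dir_deriv_def by (rule vector_derivative_diff_chain_within)
  then show ?thesis by (simp add: o_def)
qed

lemma has_real_derivative_Re_mult:
  assumes "(f has_vector_derivative f') F"
  shows "((\<lambda>t. Re (c * f t)) has_real_derivative Re (c * f')) F"
proof -
  have "((\<lambda>t. c * f t) has_vector_derivative c * f') F"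
    using has_vector_derivative_mult_right[OF assms] by simp
  then have "((\<lambda>t. Re (c * f t)) has_vector_derivative Re (c * f')) F"
    by (rule bounded_linear.has_vector_derivative[OF bounded_linear_Re])
  then show ?thesis by (simp add: has_real_derivative_iff_has_vector_derivative)
qed

section \<open>Geometry of the layers and the comparison function\<close>

context concentric_disk
begin

lemma mem_layer_iff:
  "k \<le> N \<Longrightarrow> x \<in> layer N r k \<longleftrightarrow> (1 \<le> k \<longrightarrow> cmod x \<le> r k) \<and> (k < N \<longrightarrow> r (k + 1) < cmod x)"
  using N by (auto simp: layer_def)

text \<open>The open counterpart of \<open>layer\<close>; the guards make it unbounded for
  \<open>k = 0\<close> and a full disk for \<open>k = N\<close>.\<close>

definition annulus :: "nat \<Rightarrow> complex set" where
  "annulus k = {x. (1 \<le> k \<longrightarrow> cmod x < r k) \<and> (k < N \<longrightarrow> r (k + 1) < cmod x)}"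

lemma open_annulus: "open (annulus k)"
  unfolding annulus_def
  by (cases "1 \<le> k"; cases "k < N") (simp_all add: open_Collect_conj open_norm_less open_norm_greater)

lemma annulus_subset_layer: "k \<le> N \<Longrightarrow> annulus k \<subseteq> layer N r k"
  by (auto simp: mem_layer_iff annulus_def)

lemma annulus_subset_interior: "k \<le> N \<Longrightarrow> annulus k \<subseteq> interior (layer N r k)"
  by (simp add: annulus_subset_layer interior_maximal open_annulus)

lemma layer_disjoint:
  assumes "k \<le> N" "l \<le> N" "x \<in> layer N r k" "x \<in> layer N r l"
  shows "k = l"
proof -
  have False if "k < l" "l \<le> N" "x \<in> layer N r k" "x \<in> layer N r l" for k l
    using that mem_layer_iff[of k x] mem_layer_iff[of l x] r_antimono[of "k + 1" l] by auto
  from this[of k l] this[of l k] assms show ?thesis by (cases k l rule: linorder_cases) auto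
qed

lemma layer_cover: "\<exists>k\<le>N. x \<in> layer N r k"
proof (cases "cmod x \<le> r 1")
  case True
  \<comment> \<open>The innermost circle that still encloses \<open>x\<close>.\<close>
  define k where "k = (GREATEST k. 1 \<le> k \<and> k \<le> N \<and> cmod x \<le> r k)"
  have k: "1 \<le> k \<and> k \<le> N \<and> cmod x \<le> r k"
    unfolding k_def by (rule GreatestI_nat[of _ 1 N]) (use True N in auto)
  have "r (k + 1) < cmod x" if "k < N"
  proof (rule ccontr)
    assume "\<not> r (k + 1) < cmod x"
    then have "k + 1 \<le> k"
      unfolding k_def using that k by (intro Greatest_le_nat[of _ _ N]) (auto simp: k_def)
    then show False by simp
  qed
  with k show ?thesis by (auto simp: mem_layer_iff intro!: exI[of _ k])
next
  case False
  then show ?thesis using N by (intro exI[of _ 0]) (auto simp: mem_layer_iff)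
qed

lemma layer_THE: "k \<le> N \<Longrightarrow> x \<in> layer N r k \<Longrightarrow> (THE k. k \<le> N \<and> x \<in> layer N r k) = k"
  using layer_disjoint by (intro the_equality) auto

lemma conductivity_layer: "k \<le> N \<Longrightarrow> x \<in> layer N r k \<Longrightarrow> conductivity N r s x = s k"
  by (simp add: conductivity_def layer_THE)

lemma annulus_or_circle: "(\<exists>k\<le>N. x \<in> annulus k) \<or> (\<exists>k\<in>{1..N}. cmod x = r k)"
proof -
  obtain k where k: "k \<le> N" "x \<in> layer N r k" using layer_cover by blast
  show ?thesis
  proof (cases "1 \<le> k \<and> cmod x = r k")
    case True
    with k(1) have "k \<in> {1..N}" "cmod x = r k" by auto
    then show ?thesis by blast
  next
    case False
    then have "x \<in> annulus k" using k(2) unfolding mem_layer_iff[OF k(1)] annulus_def by auto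
    with k(1) show ?thesis by blast
  qed
qed

lemma eventually_annulus_outside:
  assumes k: "k \<in> {1..N}" and z: "cmod z = r k"
  shows "eventually (\<lambda>x. x \<in> annulus (k - 1)) (at z within {x. r k < cmod x})"
proof -
  have "eventually (\<lambda>x. x \<in> {x. 1 \<le> k - 1 \<longrightarrow> cmod x < r (k - 1)}) (at z within {x. r k < cmod x})"
  proof (rule topological_tendstoD[OF tendsto_ident_at])
    show "open {x :: complex. 1 \<le> k - 1 \<longrightarrow> cmod x < r (k - 1)}"
      by (cases "1 \<le> k - 1") (simp_all add: open_norm_less)
    show "z \<in> {x. 1 \<le> k - 1 \<longrightarrow> cmod x < r (k - 1)}"
      using z k r_decreasing[of "k - 1"] by auto
  qed
  moreover have "eventually (\<lambda>x. r k < cmod x) (at z within {x. r k < cmod x})"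
    by (simp add: eventually_at_filter)
  ultimately show ?thesis
    by eventually_elim (use k in \<open>auto simp: annulus_def\<close>)
qed

lemma eventually_annulus_inside:
  assumes k: "k \<in> {1..N}" and z: "cmod z = r k"
  shows "eventually (\<lambda>x. x \<in> annulus k) (at z within {x. cmod x < r k})"
proof -
  have "eventually (\<lambda>x. x \<in> {x. k < N \<longrightarrow> r (k + 1) < cmod x}) (at z within {x. cmod x < r k})"
  proof (rule topological_tendstoD[OF tendsto_ident_at])
    show "open {x :: complex. k < N \<longrightarrow> r (k + 1) < cmod x}"
      by (cases "k < N") (simp_all add: open_norm_greater)
    show "z \<in> {x. k < N \<longrightarrow> r (k + 1) < cmod x}"
      using z k r_decreasing[of k] by auto
  qed
  moreover have "eventually (\<lambda>x. cmod x < r k) (at z within {x. cmod x < r k})"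
    by (simp add: eventually_at_filter)
  ultimately show ?thesis
    by eventually_elim (auto simp: annulus_def)
qed

text \<open>The comparison function is \<open>barrier_slope k * |x|^2 + const\<close> in layer \<open>k\<close>. The slopes make it
  strictly subharmonic there, and make \<open>s k * barrier_slope k\<close> strictly decreasing in \<open>k\<close>, so that
  its flux jumps up across each interface in the outward direction.\<close>

definition barrier_slope :: "nat \<Rightarrow> real" where
  "barrier_slope k = real (N + 1 - k) / s k"

definition barrier :: "complex \<Rightarrow> real" where
  "barrier x = barrier_slope N * (cmod x)\<^sup>2 +
    (\<Sum>j\<in>{1..N}. (barrier_slope (j - 1) - barrier_slope j) * max 0 ((cmod x)\<^sup>2 - (r j)\<^sup>2))"

lemma barrier_slope_pos: "k \<le> N \<Longrightarrow> 0 < barrier_slope k"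
  using s_pos by (simp add: barrier_slope_def)

text \<open>The product \<open>s k * barrier_slope k\<close> is the integer
  \<open>N + 1 - k\<close>.\<close>

lemma barrier_flux_jump:
  assumes "k \<in> {1..N}"
  shows "s (k - 1) * barrier_slope (k - 1) = s k * barrier_slope k + 1"
proof -
  have "0 < s (k - 1)" "0 < s k" using assms by (auto intro!: s_pos)
  then show ?thesis using assms by (simp add: barrier_slope_def of_nat_diff)
qed

lemma continuous_barrier: "isCont barrier x"
  unfolding barrier_def by (intro continuous_intros)

text \<open>The terms with \<open>j \<le> k\<close> vanish, those with \<open>j > k\<close> lose
  their \<open>max\<close>, and the slopes telescope. The bounds are non-strict so that the formula
  reaches both bounding circles.\<close>

lemma barrier_on_layer:
  assumes k: "k \<le> N"
  obtains \<beta> where "\<And>x. (1 \<le> k \<longrightarrow> cmod x \<le> r k) \<Longrightarrow> (k < N \<longrightarrow> r (k + 1) \<le> cmod x) \<Longrightarrow>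
    barrier x = barrier_slope k * (cmod x)\<^sup>2 + \<beta>"
proof
  let ?d = "\<lambda>j. barrier_slope (j - 1) - barrier_slope j"
  fix x :: complex
  assume x: "1 \<le> k \<longrightarrow> cmod x \<le> r k" "k < N \<longrightarrow> r (k + 1) \<le> cmod x"
  have "(\<Sum>j\<in>{1..N}. ?d j * max 0 ((cmod x)\<^sup>2 - (r j)\<^sup>2)) = (\<Sum>j\<in>{Suc k..N}. ?d j * ((cmod x)\<^sup>2 - (r j)\<^sup>2))"
  proof (rule sum.mono_neutral_cong_right)
    show "\<forall>j\<in>{1..N} - {Suc k..N}. ?d j * max 0 ((cmod x)\<^sup>2 - (r j)\<^sup>2) = 0"
    proof
      fix j assume "j \<in> {1..N} - {Suc k..N}"
      then have "cmod x \<le> r j" using x(1) k r_antimono[of j k] by auto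
      then have "(cmod x)\<^sup>2 \<le> (r j)\<^sup>2" by (intro power_mono) auto
      then show "?d j * max 0 ((cmod x)\<^sup>2 - (r j)\<^sup>2) = 0" by simp
    qed
    fix j assume j: "j \<in> {Suc k..N}"
    then have "r j \<le> cmod x" using x(2) k r_antimono[of "k + 1" j] by auto
    then have "(r j)\<^sup>2 \<le> (cmod x)\<^sup>2" using r_pos[of j] j by (intro power_mono) auto
    then show "?d j * max 0 ((cmod x)\<^sup>2 - (r j)\<^sup>2) = ?d j * ((cmod x)\<^sup>2 - (r j)\<^sup>2)" by simp
  qed (use k in auto)
  also have "\<dots> = (\<Sum>j\<in>{Suc k..N}. ?d j) * (cmod x)\<^sup>2 - (\<Sum>j\<in>{Suc k..N}. ?d j * (r j)\<^sup>2)"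
    by (simp only: right_diff_distrib sum_subtractf[of "\<lambda>j. ?d j * (cmod x)\<^sup>2"] sum_distrib_right)
  also have "(\<Sum>j\<in>{Suc k..N}. ?d j) = barrier_slope k - barrier_slope N"
    using sum_telescope''[OF k, of "\<lambda>j. - barrier_slope j"] by (simp add: algebra_simps)
  finally show "barrier x = barrier_slope k * (cmod x)\<^sup>2 + - (\<Sum>j\<in>{Suc k..N}. ?d j * (r j)\<^sup>2)"
    unfolding barrier_def by (simp add: algebra_simps)
qed

end

lemma div_coeff_grad_const:
  assumes S: "open S" "x \<in> S" "\<And>y. y \<in> S \<Longrightarrow> c y = \<kappa>"
    and diff: "\<And>v. v \<in> {1, \<i>} \<Longrightarrow> dir_deriv v u differentiable (at x)"
  shows "div_coeff_grad c u x = \<kappa> *\<^sub>R (dir_deriv 1 (dir_deriv 1 u) x + dir_deriv \<i> (dir_deriv \<i> u) x)"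
proof -
  have "dir_deriv v (\<lambda>w. c w *\<^sub>R dir_deriv v u w) x = \<kappa> *\<^sub>R dir_deriv v (dir_deriv v u) x"
    if v: "v \<in> {1, \<i>}" for v
  proof -
    have "dir_deriv v (\<lambda>w. c w *\<^sub>R dir_deriv v u w) x = dir_deriv v (\<lambda>w. \<kappa> *\<^sub>R dir_deriv v u w) x"
      by (rule dir_deriv_cong_open[OF S(1,2)]) (simp add: S(3))
    also have "\<dots> = \<kappa> *\<^sub>R dir_deriv v (dir_deriv v u) x"
      unfolding dir_deriv_def[of v "dir_deriv v u" x]
      by (rule dir_deriv_eq)
        (rule has_derivative_scaleR_right[OF diff[OF v, unfolded frechet_derivative_works]])
    finally show ?thesis .
  qed
  from this[of 1] this[of \<i>] show ?thesis
    by (simp add: div_coeff_grad_def scaleR_add_right)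
qed

section \<open>Maximum principle for the difference of two solutions\<close>

context concentric_disk
begin

lemma solution_C2: "transmission_solution N r s H u \<Longrightarrow> k \<le> N \<Longrightarrow> C2_on (interior (layer N r k)) u"
  by (simp add: transmission_solution_def)

lemma solution_differentiable:
  assumes "transmission_solution N r s H u" "k \<le> N" "x \<in> annulus k"
  shows "u differentiable (at x)"
    and "v \<in> {1, \<i>} \<Longrightarrow> dir_deriv v u differentiable (at x)"
  using solution_C2[OF assms(1,2)] annulus_subset_interior[OF assms(2)] assms(3)
  unfolding C2_on_def by blast+

lemma solution_interface:
  assumes "transmission_solution N r s H u" "k \<in> {1..N}" "cmod z = r k"
  shows "outer_limit (r k) u z (u z)" "inner_limit (r k) u z (u z)"
    and "\<exists>gp gm. outer_limit (r k) (normal_deriv u) z gp \<and> inner_limit (r k) (normal_deriv u) z gm \<and>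
      s (k - 1) *\<^sub>R gp = s k *\<^sub>R gm"
  using assms unfolding transmission_solution_def by blast+

lemma solution_isCont:
  assumes sol: "transmission_solution N r s H u"
  shows "isCont u x"
  using annulus_or_circle[of x]
proof
  assume "\<exists>k\<le>N. x \<in> annulus k"
  then show ?thesis
    using solution_differentiable(1)[OF sol] differentiable_imp_continuous_within by blast
next
  assume "\<exists>k\<in>{1..N}. cmod x = r k"
  then obtain k where k: "k \<in> {1..N}" "cmod x = r k" by blast
  with r_pos[of k] solution_interface(1,2)[OF sol k(1)] show ?thesis
    by (intro isCont_of_traces[of "r k" x u]) auto
qed

lemma solution_laplace:
  assumes sol: "transmission_solution N r s H u" and k: "k \<le> N" and x: "x \<in> annulus k"
  shows "dir_deriv 1 (dir_deriv 1 u) x + dir_deriv \<i> (dir_deriv \<i> u) x = 0"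
proof -
  have "div_coeff_grad (conductivity N r s) u x =
      s k *\<^sub>R (dir_deriv 1 (dir_deriv 1 u) x + dir_deriv \<i> (dir_deriv \<i> u) x)"
    using annulus_subset_layer[OF k] conductivity_layer[OF k] solution_differentiable(2)[OF sol k x]
    by (intro div_coeff_grad_const[OF open_annulus x]) auto
  moreover have "div_coeff_grad (conductivity N r s) u x = 0"
    using sol k x annulus_subset_interior[OF k] unfolding transmission_solution_def by blast
  ultimately show ?thesis using s_pos[OF k] by auto
qed

context
  fixes H u1 u2 :: "complex \<Rightarrow> complex" and c :: complex and \<epsilon> :: real
  assumes sol1: "transmission_solution N r s H u1" and sol2: "transmission_solution N r s H u2"
    and eps: "0 < \<epsilon>"
begin

text \<open>The free constant \<open>c\<close> lets one real-valued maximum principle control the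
  complex difference.\<close>

definition perturbed :: "complex \<Rightarrow> real" where
  "perturbed x = Re (c * (u1 x - u2 x)) + \<epsilon> * barrier x"

text \<open>The second derivative tests in directions \<open>1\<close> and \<open>\<i>\<close> add
  up to the Laplacian: the solutions contribute 0 and the barrier contributes
  \<open>\<epsilon> * (barrier_slope k * 4)\<close>, which is positive.\<close>

lemma perturbed_no_max_annulus:
  assumes k: "k \<le> N" and z: "z \<in> annulus k" and d: "0 < d"
    and max: "\<And>x. dist z x < d \<Longrightarrow> perturbed x \<le> perturbed z"
  shows False
proof -
  let ?\<alpha> = "barrier_slope k"
  obtain \<beta> where \<beta>: "\<And>x. (1 \<le> k \<longrightarrow> cmod x \<le> r k) \<Longrightarrow> (k < N \<longrightarrow> r (k + 1) \<le> cmod x) \<Longrightarrow>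
    barrier x = ?\<alpha> * (cmod x)\<^sup>2 + \<beta>"
    using barrier_on_layer[OF k] by metis
  obtain d0 where d0: "0 < d0" "ball z d0 \<subseteq> annulus k"
    using open_annulus z by (meson openE)
  define d' where "d' = min d d0"
  have d': "0 < d'" "d' \<le> d" "ball z d' \<subseteq> annulus k"
    using d d0 by (auto simp: d'_def)
  have *: "Re (c * (dir_deriv e (dir_deriv e u1) z - dir_deriv e (dir_deriv e u2) z)) + \<epsilon> * (?\<alpha> * 2) \<le> 0"
    if e: "e \<in> {1, \<i>}" for e
  proof -
    \<comment> \<open>\<open>perturbed\<close> along the line through \<open>z\<close>, with the
      squared modulus expanded using \<open>cmod e = 1\<close>, so that it can be differentiated
      explicitly.\<close>
    define g where "g t = Re (c * (u1 (z + t *\<^sub>R e) - u2 (z + t *\<^sub>R e))) +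
      \<epsilon> * (?\<alpha> * ((cmod z)\<^sup>2 + 2 * t * Re (z * cnj e) + t\<^sup>2) + \<beta>)" for t
    define g' where "g' t = Re (c * (dir_deriv e u1 (z + t *\<^sub>R e) - dir_deriv e u2 (z + t *\<^sub>R e))) +
      \<epsilon> * (?\<alpha> * (2 * Re (z * cnj e) + 2 * t))" for t
    have e1: "cmod e = 1" using e by auto
    have line: "z + t *\<^sub>R e \<in> annulus k" "dist z (z + t *\<^sub>R e) < d" if "\<bar>t\<bar> < d'" for t
      using that d' e1 by (auto simp: dist_norm)
    have g_eq: "g t = perturbed (z + t *\<^sub>R e)" if t: "\<bar>t\<bar> < d'" for t
    proof -
      have "(cmod (z + t *\<^sub>R e))\<^sup>2 = (cmod z)\<^sup>2 + 2 * t * Re (z * cnj e) + t\<^sup>2"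
        using e unfolding cmod_power2 by (auto simp: power2_eq_square algebra_simps)
      moreover have "barrier (z + t *\<^sub>R e) = ?\<alpha> * (cmod (z + t *\<^sub>R e))\<^sup>2 + \<beta>"
        using line(1)[OF t] by (intro \<beta>) (auto simp: annulus_def)
      ultimately show ?thesis by (simp add: g_def perturbed_def)
    qed
    show ?thesis
    proof (rule second_derivative_at_local_max[OF d'(1), where g = g and g' = g'])
      fix t assume t: "\<bar>t\<bar> < d'"
      note D = has_real_derivative_Re_mult[OF has_vector_derivative_diff[OF
            has_vector_derivative_line[OF solution_differentiable(1)[OF sol1 k line(1)[OF t]]]
            has_vector_derivative_line[OF solution_differentiable(1)[OF sol2 k line(1)[OF t]]]], of c]
      show "(g has_real_derivative g' t) (at t)"
        unfolding g_def g'_def by (rule DERIV_add[OF D]) (auto intro!: derivative_eq_intros)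
      have "perturbed (z + t *\<^sub>R e) \<le> perturbed (z + 0 *\<^sub>R e)" using max[OF line(2)[OF t]] by simp
      then show "g t \<le> g 0" using g_eq[OF t] g_eq[of 0] d' by simp
    next
      have z0: "z + 0 *\<^sub>R e \<in> annulus k" using z by simp
      note D = has_real_derivative_Re_mult[OF has_vector_derivative_diff[OF
            has_vector_derivative_line[OF solution_differentiable(2)[OF sol1 k z0 e]]
            has_vector_derivative_line[OF solution_differentiable(2)[OF sol2 k z0 e]]], of c]
      have "(g' has_real_derivative Re (c * (dir_deriv e (dir_deriv e u1) (z + 0 *\<^sub>R e) -
          dir_deriv e (dir_deriv e u2) (z + 0 *\<^sub>R e))) + \<epsilon> * (?\<alpha> * 2)) (at 0)"
        unfolding g'_def by (rule DERIV_add[OF D]) (auto intro!: derivative_eq_intros)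
      then show "(g' has_real_derivative Re (c * (dir_deriv e (dir_deriv e u1) z -
          dir_deriv e (dir_deriv e u2) z)) + \<epsilon> * (?\<alpha> * 2)) (at 0)" by simp
    qed
  qed
  have "Re (c * (dir_deriv 1 (dir_deriv 1 u1) z - dir_deriv 1 (dir_deriv 1 u2) z)) +
      Re (c * (dir_deriv \<i> (dir_deriv \<i> u1) z - dir_deriv \<i> (dir_deriv \<i> u2) z)) =
      Re (c * ((dir_deriv 1 (dir_deriv 1 u1) z + dir_deriv \<i> (dir_deriv \<i> u1) z) -
        (dir_deriv 1 (dir_deriv 1 u2) z + dir_deriv \<i> (dir_deriv \<i> u2) z)))"
    unfolding plus_complex.sel(1)[symmetric] by (simp only: algebra_simps)
  also have "\<dots> = 0"
    unfolding solution_laplace[OF sol1 k z] solution_laplace[OF sol2 k z] by simp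
  finally have "\<epsilon> * (?\<alpha> * 4) \<le> 0" using *[of 1] *[of \<i>] by simp
  then show False using eps barrier_slope_pos[OF k] by (simp add: mult_le_0_iff)
qed

text \<open>At a maximum the outer radial derivative is at most 0 and the inner one at least 0.
  Weighted with the conductivities, the fluxes of the solutions cancel, while the outer barrier flux
  exceeds the inner one by \<open>\<epsilon> * (2 * r k)\<close>.\<close>

lemma perturbed_no_max_circle:
  assumes k: "k \<in> {1..N}" and z: "cmod z = r k" and d: "0 < d"
    and max: "\<And>x. dist z x < d \<Longrightarrow> perturbed x \<le> perturbed z"
  shows False
proof -
  have \<rho>: "0 < r k" using r_pos k by auto
  define e where "e = z /\<^sub>R r k"
  have e1: "cmod e = 1" using z \<rho> by (simp add: e_def)
  have ze: "z = r k *\<^sub>R e" using \<rho> by (simp add: e_def)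
  have dist_ray: "dist z (t *\<^sub>R e) = \<bar>t - r k\<bar>" for t
    unfolding ze dist_norm scaleR_left_diff_distrib[symmetric] using e1 by simp
  have normal: "normal_deriv u (t *\<^sub>R e) = dir_deriv e u (0 + t *\<^sub>R e)" if "0 < t" for u t
    using that e1 by (simp add: normal_deriv_def)
  obtain gp1 gm1 where g1: "outer_limit (r k) (normal_deriv u1) z gp1"
    "inner_limit (r k) (normal_deriv u1) z gm1" "s (k - 1) *\<^sub>R gp1 = s k *\<^sub>R gm1"
    using solution_interface(3)[OF sol1 k z] by blast
  obtain gp2 gm2 where g2: "outer_limit (r k) (normal_deriv u2) z gp2"
    "inner_limit (r k) (normal_deriv u2) z gm2" "s (k - 1) *\<^sub>R gp2 = s k *\<^sub>R gm2"
    using solution_interface(3)[OF sol2 k z] by blast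
  note out = filterlim_compose[OF _ filterlim_ray_outer[OF z \<rho>, folded e_def]]
  note inn = filterlim_compose[OF _ filterlim_ray_inner[OF z \<rho>, folded e_def]]
  \<comment> \<open>The parameters \<open>\<alpha>\<close>, \<open>\<beta>\<close> allow the same
    radial restriction to be used with the barrier formula of either adjacent layer.\<close>
  define h where "h \<alpha> \<beta> t = Re (c * (u1 (0 + t *\<^sub>R e) - u2 (0 + t *\<^sub>R e))) + \<epsilon> * (\<alpha> * t\<^sup>2 + \<beta>)" for \<alpha> \<beta> t
  define h' where "h' \<alpha> t = Re (c * (normal_deriv u1 (t *\<^sub>R e) - normal_deriv u2 (t *\<^sub>R e))) + \<epsilon> * (\<alpha> * (2 * t))" for \<alpha> t
  have D: "(h \<alpha> \<beta> has_real_derivative h' \<alpha> t) (at t)"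
    if "0 < t" "l \<le> N" "t *\<^sub>R e \<in> annulus l" for t l \<alpha> \<beta>
  proof -
    have l: "0 + t *\<^sub>R e \<in> annulus l" using that by simp
    note D = has_real_derivative_Re_mult[OF has_vector_derivative_diff[OF
          has_vector_derivative_line[OF solution_differentiable(1)[OF sol1 that(2) l]]
          has_vector_derivative_line[OF solution_differentiable(1)[OF sol2 that(2) l]]], of c]
    show ?thesis
      unfolding h_def h'_def normal[OF that(1)]
      by (rule DERIV_add[OF D]) (auto intro!: derivative_eq_intros)
  qed
  have "Re (c * (gp1 - gp2)) + \<epsilon> * (barrier_slope (k - 1) * (2 * r k)) \<le> 0"
  proof -
    obtain \<beta> where \<beta>: "\<And>x. (1 \<le> k - 1 \<longrightarrow> cmod x \<le> r (k - 1)) \<Longrightarrow> (k - 1 < N \<longrightarrow> r (k - 1 + 1) \<le> cmod x) \<Longrightarrow>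
        barrier x = barrier_slope (k - 1) * (cmod x)\<^sup>2 + \<beta>"
      using barrier_on_layer[of "k - 1"] k by (metis atLeastAtMost_iff diff_le_self le_trans)
    \<comment> \<open>For \<open>k = 1\<close> the outer region is unbounded, so any positive length
      would do.\<close>
    define d' where "d' = min d (if k = 1 then 1 else r (k - 1) - r k)"
    have d': "0 < d'" "d' \<le> d" "1 \<le> k - 1 \<Longrightarrow> d' \<le> r (k - 1) - r k"
      using d r_decreasing[of "k - 1"] k by (auto simp: d'_def)
    have eq: "h (barrier_slope (k - 1)) \<beta> t = perturbed (t *\<^sub>R e)" if "r k \<le> t" "t < r k + d'" for t
    proof -
      have "barrier (t *\<^sub>R e) = barrier_slope (k - 1) * (cmod (t *\<^sub>R e))\<^sup>2 + \<beta>"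
        using that d' e1 \<rho> k by (intro \<beta>) auto
      then show ?thesis using e1 by (simp add: h_def perturbed_def)
    qed
    show ?thesis
    proof (rule right_derivative_limit_at_max[OF d'(1), where p = "r k" and
          h = "h (barrier_slope (k - 1)) \<beta>" and h' = "h' (barrier_slope (k - 1))"])
      fix t assume t: "r k < t" "t < r k + d'"
      show "(h (barrier_slope (k - 1)) \<beta> has_real_derivative h' (barrier_slope (k - 1)) t) (at t)"
        using t \<rho> e1 d' k by (intro D[of _ "k - 1"]) (auto simp: annulus_def)
      show "h (barrier_slope (k - 1)) \<beta> t \<le> h (barrier_slope (k - 1)) \<beta> (r k)"
        using eq[of t] eq[of "r k"] t d' max[of "t *\<^sub>R e"] dist_ray[of t] ze by simp
    next
      show "(h (barrier_slope (k - 1)) \<beta> \<longlongrightarrow> h (barrier_slope (k - 1)) \<beta> (r k)) (at_right (r k))"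
        using out[OF solution_interface(1)[OF sol1 k z, unfolded outer_limit_def]]
          out[OF solution_interface(1)[OF sol2 k z, unfolded outer_limit_def]]
        unfolding h_def add_0 ze[symmetric] by (intro tendsto_intros)
      show "(h' (barrier_slope (k - 1)) \<longlongrightarrow>
          Re (c * (gp1 - gp2)) + \<epsilon> * (barrier_slope (k - 1) * (2 * r k))) (at_right (r k))"
        using out[OF g1(1)[unfolded outer_limit_def]] out[OF g2(1)[unfolded outer_limit_def]]
        unfolding h'_def by (intro tendsto_intros)
    qed
  qed
  moreover have "0 \<le> Re (c * (gm1 - gm2)) + \<epsilon> * (barrier_slope k * (2 * r k))"
  proof -
    obtain \<beta> where \<beta>: "\<And>x. (1 \<le> k \<longrightarrow> cmod x \<le> r k) \<Longrightarrow> (k < N \<longrightarrow> r (k + 1) \<le> cmod x) \<Longrightarrow>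
        barrier x = barrier_slope k * (cmod x)\<^sup>2 + \<beta>"
      using barrier_on_layer[of k] k by (metis atLeastAtMost_iff)
    define d' where "d' = min d (if k = N then r k else r k - r (k + 1))"
    \<comment> \<open>The bound by \<open>r k\<close> keeps the ray parameter positive, also in the
      core.\<close>
    have d': "0 < d'" "d' \<le> d" "d' \<le> r k" "k < N \<Longrightarrow> d' \<le> r k - r (k + 1)"
      using d r_decreasing[of k] k \<rho> r_pos[of "k + 1"] by (auto simp: d'_def)
    have eq: "h (barrier_slope k) \<beta> t = perturbed (t *\<^sub>R e)" if "r k - d' < t" "t \<le> r k" for t
    proof -
      have "barrier (t *\<^sub>R e) = barrier_slope k * (cmod (t *\<^sub>R e))\<^sup>2 + \<beta>"
        using that d' e1 \<rho> k by (intro \<beta>) auto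
      then show ?thesis using e1 by (simp add: h_def perturbed_def)
    qed
    show ?thesis
    proof (rule left_derivative_limit_at_max[OF d'(1), where p = "r k" and
          h = "h (barrier_slope k) \<beta>" and h' = "h' (barrier_slope k)"])
      fix t assume t: "r k - d' < t" "t < r k"
      show "(h (barrier_slope k) \<beta> has_real_derivative h' (barrier_slope k) t) (at t)"
        using t \<rho> e1 d' k by (intro D[of _ k]) (auto simp: annulus_def)
      show "h (barrier_slope k) \<beta> t \<le> h (barrier_slope k) \<beta> (r k)"
        using eq[of t] eq[of "r k"] t d' max[of "t *\<^sub>R e"] dist_ray[of t] ze by simp
    next
      show "(h (barrier_slope k) \<beta> \<longlongrightarrow> h (barrier_slope k) \<beta> (r k)) (at_left (r k))"
        using inn[OF solution_interface(2)[OF sol1 k z, unfolded inner_limit_def]]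
          inn[OF solution_interface(2)[OF sol2 k z, unfolded inner_limit_def]]
        unfolding h_def add_0 ze[symmetric] by (intro tendsto_intros)
      show "(h' (barrier_slope k) \<longlongrightarrow>
          Re (c * (gm1 - gm2)) + \<epsilon> * (barrier_slope k * (2 * r k))) (at_left (r k))"
        using inn[OF g1(2)[unfolded inner_limit_def]] inn[OF g2(2)[unfolded inner_limit_def]]
        unfolding h'_def by (intro tendsto_intros)
    qed
  qed
  ultimately have "s (k - 1) * (Re (c * (gp1 - gp2)) + \<epsilon> * (barrier_slope (k - 1) * (2 * r k))) \<le>
      s k * (Re (c * (gm1 - gm2)) + \<epsilon> * (barrier_slope k * (2 * r k)))"
    using s_pos[of k] s_pos[of "k - 1"] k
    by (intro order_trans[OF mult_nonneg_nonpos mult_nonneg_nonneg]) (auto simp: less_imp_le)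
  moreover have "s (k - 1) * Re (c * (gp1 - gp2)) = s k * Re (c * (gm1 - gm2))"
  proof -
    have "s (k - 1) * Re (c * (gp1 - gp2)) = Re (c * (s (k - 1) *\<^sub>R gp1 - s (k - 1) *\<^sub>R gp2))"
      by (simp add: algebra_simps)
    also have "\<dots> = s k * Re (c * (gm1 - gm2))"
      unfolding g1(3) g2(3) by (simp add: algebra_simps)
    finally show ?thesis .
  qed
  ultimately have "\<epsilon> * (2 * r k) * (s (k - 1) * barrier_slope (k - 1)) \<le> \<epsilon> * (2 * r k) * (s k * barrier_slope k)"
    by (simp add: algebra_simps)
  then have "\<epsilon> * (2 * r k) \<le> 0" unfolding barrier_flux_jump[OF k] by (simp add: algebra_simps)
  then show False using eps \<rho> by (simp add: mult_le_0_iff)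
qed

text \<open>A maximum over the closed disk exists by continuity across the interfaces; were it
  interior, it would be a local maximum in an annulus or on an interface.\<close>

lemma perturbed_le_boundary:
  assumes R: "0 < R" and z: "cmod z \<le> R"
  obtains y where "cmod y = R" "perturbed z \<le> perturbed y"
proof -
  have "continuous_on (cball 0 R) perturbed"
    unfolding perturbed_def
    using solution_isCont[OF sol1] solution_isCont[OF sol2] continuous_barrier
    by (intro continuous_at_imp_continuous_on ballI continuous_intros)
  moreover have "compact (cball (0 :: complex) R)" "cball (0 :: complex) R \<noteq> {}" using R by auto
  ultimately obtain y where y: "y \<in> cball 0 R" "\<And>x. x \<in> cball 0 R \<Longrightarrow> perturbed x \<le> perturbed y"
    using continuous_attains_sup by metis
  have "cmod y = R"
  proof (rule ccontr)
    assume "cmod y \<noteq> R"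
    then have d: "0 < R - cmod y" using y(1) by simp
    have max: "perturbed x \<le> perturbed y" if "dist y x < R - cmod y" for x
    proof (rule y(2))
      have "cmod x \<le> cmod y + cmod (x - y)" by (metis norm_triangle_sub)
      then show "x \<in> cball 0 R" using that by (simp add: dist_norm norm_minus_commute)
    qed
    show False
      using annulus_or_circle[of y] perturbed_no_max_annulus[OF _ _ d max] perturbed_no_max_circle[OF _ _ d max]
      by blast
  qed
  with y(2)[of z] z that show ?thesis by auto
qed

end

lemma solution_tendsto_background:
  assumes "transmission_solution N r s H u"
  shows "((\<lambda>x. u x - H x) \<longlongrightarrow> 0) at_infinity"
proof -
  have "(\<lambda>x. cmod (u x - H x)) \<in> O[at_infinity](\<lambda>x. 1 / cmod x)"
    using assms by (simp add: transmission_solution_def)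
  then obtain K where "eventually (\<lambda>x. norm (cmod (u x - H x)) \<le> K * norm (1 / cmod x)) at_infinity"
    by (elim landau_o.bigE)
  then have "eventually (\<lambda>x. norm (u x - H x) \<le> norm (inverse x) * K) at_infinity"
    by eventually_elim (simp add: norm_inverse norm_divide divide_inverse mult.commute)
  then show ?thesis
    by (rule tendsto_0_le[OF tendsto_inverse_0])
qed

text \<open>First \<open>R\<close> is chosen so large that the difference is below
  \<open>\<delta>\<close> on the circle of radius \<open>R\<close>, and only then
  \<open>\<epsilon>\<close>, since the oscillation of the barrier depends on
  \<open>R\<close>.\<close>

lemma solution_comparison:
  assumes sol1: "transmission_solution N r s H u1" and sol2: "transmission_solution N r s H u2"
  shows "Re (c * (u1 z - u2 z)) \<le> 0"
proof (rule field_le_epsilon)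
  fix \<delta>' :: real assume \<delta>': "0 < \<delta>'"
  define \<delta> where "\<delta> = \<delta>' / 2"
  have \<delta>: "0 < \<delta>" using \<delta>' by (simp add: \<delta>_def)
  have "((\<lambda>x. Re (c * ((u1 x - H x) - (u2 x - H x)))) \<longlongrightarrow> Re (c * (0 - 0))) at_infinity"
    using solution_tendsto_background[OF sol1] solution_tendsto_background[OF sol2]
    by (intro tendsto_intros)
  then have "((\<lambda>x. Re (c * (u1 x - u2 x))) \<longlongrightarrow> 0) at_infinity" by simp
  then have "eventually (\<lambda>x. Re (c * (u1 x - u2 x)) < \<delta>) at_infinity"
    using \<delta> by (rule order_tendstoD(2))
  then obtain b where b: "\<And>x. b \<le> cmod x \<Longrightarrow> Re (c * (u1 x - u2 x)) < \<delta>"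
    unfolding eventually_at_infinity by blast
  define R where "R = Max {b, cmod z, 1}"
  have R: "b \<le> R" "cmod z \<le> R" "0 < R" by (auto simp: R_def less_max_iff_disj)
  have "continuous_on (cball 0 R) barrier"
    using continuous_barrier by (intro continuous_at_imp_continuous_on ballI)
  moreover have "compact (cball (0 :: complex) R)" "cball (0 :: complex) R \<noteq> {}" using R by auto
  ultimately obtain m where m: "\<And>x. x \<in> cball 0 R \<Longrightarrow> barrier x \<le> barrier m"
    using continuous_attains_sup by metis
  define K where "K = barrier m - barrier z"
  have K: "0 \<le> K" using m[of z] R by (simp add: K_def)
  \<comment> \<open>Makes \<open>\<epsilon> * K\<close> at most \<open>\<delta>\<close>; adding 1
    covers the case \<open>K = 0\<close>.\<close>
  define \<epsilon> where "\<epsilon> = \<delta> / (K + 1)"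
  have \<epsilon>: "0 < \<epsilon>" using \<delta> K by (simp add: \<epsilon>_def)
  obtain y where y: "cmod y = R"
    "Re (c * (u1 z - u2 z)) + \<epsilon> * barrier z \<le> Re (c * (u1 y - u2 y)) + \<epsilon> * barrier y"
    using perturbed_le_boundary[OF sol1 sol2 \<epsilon> R(3,2)]
    unfolding perturbed_def[OF sol1 sol2 \<epsilon>] by blast
  have "\<epsilon> * barrier y \<le> \<epsilon> * barrier m"
    using m[of y] y(1) \<epsilon> by simp
  with y(2) b[of y] R(1) y(1) have "Re (c * (u1 z - u2 z)) \<le> \<delta> + \<epsilon> * K"
    by (simp add: K_def right_diff_distrib)
  also have "\<epsilon> * K \<le> \<delta>" using \<delta> K by (simp add: \<epsilon>_def field_simps)
  finally show "Re (c * (u1 z - u2 z)) \<le> 0 + \<delta>'" by (simp add: \<delta>_def)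
qed

text \<open>For fixed \<open>z\<close>, taking \<open>c\<close> to be the conjugate of the
  difference at \<open>z\<close> turns the comparison into a bound on its squared modulus.\<close>

lemma solution_unique:
  assumes sol1: "transmission_solution N r s H u1" and sol2: "transmission_solution N r s H u2"
  shows "u1 = u2"
proof
  fix z
  have "(cmod (u1 z - u2 z))\<^sup>2 = Re (cnj (u1 z - u2 z) * (u1 z - u2 z))"
    unfolding mult.commute[of "cnj _"] complex_norm_square[symmetric] by simp
  also have "\<dots> \<le> 0" by (rule solution_comparison[OF sol1 sol2])
  finally show "u1 z = u2 z" by simp
qed

end

section \<open>Existence\<close>

definition entire_coeffs :: "(nat \<Rightarrow> complex) \<Rightarrow> bool" where
  "entire_coeffs c \<longleftrightarrow> (\<forall>z. summable (\<lambda>n. c n * z ^ n))"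

definition ps :: "(nat \<Rightarrow> complex) \<Rightarrow> complex \<Rightarrow> complex" where
  "ps c z = (\<Sum>n. c n * z ^ n)"

lemma ps_sums: "entire_coeffs c \<Longrightarrow> (\<lambda>n. c n * z ^ n) sums ps c z"
  unfolding entire_coeffs_def ps_def by (simp add: summable_sums)

lemma ps_eqI: "(\<lambda>n. c n * z ^ n) sums l \<Longrightarrow> ps c z = l"
  unfolding ps_def by (rule sums_unique[symmetric])

text \<open>Comparison with the absolutely convergent series of \<open>c\<close> at the dilated
  point \<open>B * z\<close>; the term of index 0 vanishes.\<close>

lemma entire_coeffs_exp_bounded:
  assumes c: "entire_coeffs c" "c 0 = 0" and f: "exp_bounded f"
  shows "entire_coeffs (\<lambda>n. of_real (f n) * c n)"
  unfolding entire_coeffs_def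
proof
  fix z :: complex
  obtain C B where CB: "0 \<le> C" "0 \<le> B" "\<And>n. n \<ge> 1 \<Longrightarrow> \<bar>f n\<bar> \<le> C * B ^ n"
    using f unfolding exp_bounded_def by blast
  have "summable (\<lambda>n. norm (c n * (of_real B * z) ^ n))"
    \<comment> \<open>The real point \<open>B * cmod z + 1\<close> has strictly larger modulus than
      \<open>B * z\<close>, which gives absolute convergence at the latter.\<close>
    using c(1) unfolding entire_coeffs_def
    by (intro powser_insidea[of c "of_real (B * cmod z + 1)"]) (use CB in \<open>auto simp: norm_mult simp del: of_real_add of_real_mult\<close>)
  then have "summable (\<lambda>n. C * norm (c n * (of_real B * z) ^ n))"
    by (rule summable_mult)
  then show "summable (\<lambda>n. of_real (f n) * c n * z ^ n)"
  proof (rule summable_comparison_test'[where N = 0])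
    fix n
    show "norm (of_real (f n) * c n * z ^ n) \<le> C * norm (c n * (of_real B * z) ^ n)"
    proof (cases "n = 0")
      case False
      then have "\<bar>f n\<bar> * (cmod (c n) * cmod z ^ n) \<le> (C * B ^ n) * (cmod (c n) * cmod z ^ n)"
        using CB(3)[of n] by (intro mult_right_mono) auto
      then show ?thesis
        using CB by (simp add: norm_mult norm_power power_mult_distrib algebra_simps)
    qed (use c CB in auto)
  qed
qed

lemma entire_coeffs_cnj:
  assumes "entire_coeffs c"
  shows "entire_coeffs (\<lambda>n. cnj (c n))"
  unfolding entire_coeffs_def
proof
  fix z
  have "(\<lambda>n. cnj (c n * cnj z ^ n)) sums cnj (ps c (cnj z))"
    unfolding sums_cnj by (rule ps_sums[OF assms])
  then have "summable (\<lambda>n. cnj (c n * cnj z ^ n))" by (rule sums_summable)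
  then show "summable (\<lambda>n. cnj (c n) * z ^ n)" by simp
qed

lemma ps_has_field_derivative:
  assumes "entire_coeffs c"
  shows "(ps c has_field_derivative ps (diffs c) z) (at z)"
  unfolding ps_def[abs_def]
  by (rule termdiffs_strong_converges_everywhere) (use assms in \<open>simp add: entire_coeffs_def\<close>)

lemma ps_holomorphic: "entire_coeffs c \<Longrightarrow> ps c holomorphic_on S"
  by (rule holomorphic_on_subset[of _ UNIV])
    (auto simp: holomorphic_on_open intro: ps_has_field_derivative)

text \<open>The extra factor \<open>z\<close> restores the exponent \<open>n\<close>, so that
  derivatives can be compared mode by mode with the series itself.\<close>

lemma ps_deriv_sums:
  assumes "entire_coeffs c"
  shows "(\<lambda>n. of_nat n * c n * z ^ n) sums (ps (diffs c) z * z)"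
proof -
  have "summable (\<lambda>n. diffs c n * z ^ n)"
    by (rule termdiff_converges_all) (use assms in \<open>simp add: entire_coeffs_def\<close>)
  from sums_mult2[OF diffs_equiv[OF this], of z]
  have "(\<lambda>n. of_nat n * c n * z ^ (n - Suc 0) * z) sums (ps (diffs c) z * z)"
    by (simp add: ps_def)
  moreover have "of_nat n * c n * z ^ (n - Suc 0) * z = of_nat n * c n * z ^ n" for n
    by (cases n) (auto simp: algebra_simps)
  ultimately show ?thesis by simp
qed

text \<open>Functions of the form \<open>f + cnj g\<close> with \<open>f\<close>, \<open>g\<close> holomorphic are closed under real
  directional derivatives, which yields their regularity and harmonicity.\<close>

lemma holomorphic_plus_cnj_has_derivative:
  assumes S: "open S" "z \<in> S" and f: "f holomorphic_on S" and g: "g holomorphic_on S"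
    and u: "\<And>z. z \<in> S \<Longrightarrow> u z = f z + cnj (g z)"
  shows "(u has_derivative (\<lambda>v. deriv f z * v + cnj (deriv g z * v))) (at z)"
proof -
  have "(f has_derivative (\<lambda>v. deriv f z * v)) (at z)" "(g has_derivative (\<lambda>v. deriv g z * v)) (at z)"
    using holomorphic_derivI[OF f S] holomorphic_derivI[OF g S]
    by (simp_all add: has_field_derivative_def)
  then have "((\<lambda>z. f z + cnj (g z)) has_derivative (\<lambda>v. deriv f z * v + cnj (deriv g z * v))) (at z)"
    by (intro has_derivative_add has_derivative_cnj)
  then show ?thesis
    by (rule has_derivative_transform_within_open[OF _ S]) (simp add: u)
qed

lemma holomorphic_plus_cnj_dir_deriv:
  assumes "open S" "z \<in> S" "f holomorphic_on S" "g holomorphic_on S"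
    and "\<And>z. z \<in> S \<Longrightarrow> u z = f z + cnj (g z)"
  shows "dir_deriv v u z = deriv f z * v + cnj (deriv g z * v)"
  by (rule dir_deriv_eq[OF holomorphic_plus_cnj_has_derivative[OF assms]])

lemma holomorphic_plus_cnj_harmonic:
  assumes S: "open S" and f: "f holomorphic_on S" and g: "g holomorphic_on S"
    and u: "\<And>z. z \<in> S \<Longrightarrow> u z = f z + cnj (g z)"
  shows "harmonic_on S u"
proof -
  have hol: "(\<lambda>z. deriv f z * v) holomorphic_on S" "(\<lambda>z. deriv g z * v) holomorphic_on S" for v
    using S f g by (auto intro!: holomorphic_intros)
  have D1: "dir_deriv v u z = deriv f z * v + cnj (deriv g z * v)" if "z \<in> S" for v z
    by (rule holomorphic_plus_cnj_dir_deriv[OF S that f g u])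
  have D2: "dir_deriv w (dir_deriv v u) z = deriv (deriv f) z * v * w + cnj (deriv (deriv g) z * v * w)"
    if z: "z \<in> S" for v w z
  proof -
    have "deriv f field_differentiable (at z)" "deriv g field_differentiable (at z)"
      using S f g z by (meson holomorphic_deriv holomorphic_on_imp_differentiable_at)+
    moreover have "dir_deriv w (dir_deriv v u) z =
        deriv (\<lambda>z. deriv f z * v) z * w + cnj (deriv (\<lambda>z. deriv g z * v) z * w)"
      by (rule holomorphic_plus_cnj_dir_deriv[OF S z hol]) (rule D1)
    ultimately show ?thesis by simp
  qed
  have diff: "u differentiable (at z)" if "z \<in> S" for z
    using holomorphic_plus_cnj_has_derivative[OF S that f g u] unfolding differentiable_def by blast
  have diff': "dir_deriv v u differentiable (at z)" if "z \<in> S" for v z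
    using holomorphic_plus_cnj_has_derivative[OF S that hol D1] unfolding differentiable_def by blast
  have "continuous_on S (dir_deriv w (dir_deriv v u))" for v w
  proof -
    have "continuous_on S (deriv (deriv f))" "continuous_on S (deriv (deriv g))"
      using S f g by (auto intro!: holomorphic_on_imp_continuous_on holomorphic_deriv)
    then have "continuous_on S (\<lambda>z. deriv (deriv f) z * v * w + cnj (deriv (deriv g) z * v * w))"
      by (intro continuous_intros)
    then show ?thesis by (rule continuous_on_eq) (simp add: D2)
  qed
  \<comment> \<open>For \<open>v = w = \<i>\<close> the product \<open>v * w\<close> is -1, so the
    two pure second derivatives cancel.\<close>
  then show ?thesis
    unfolding harmonic_on_def C2_on_def using diff diff' by (auto simp: D2 mult.assoc)
qed

section \<open>Construction of the layer potentials and their matching\<close>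

locale concentric_disk_background = concentric_disk +
  fixes a :: "nat \<Rightarrow> complex" and H :: "complex \<Rightarrow> complex"
  assumes a_0: "a 0 = 0"
    and H_sums: "\<And>z. (\<lambda>n. a n * z ^ n) sums H z"
begin

lemma entire_a: "entire_coeffs a"
  using H_sums unfolding entire_coeffs_def by (blast intro: sums_summable)

definition inner_coeff :: "nat \<Rightarrow> nat \<Rightarrow> complex" where
  "inner_coeff k n = of_real (P k n) * a n"

text \<open>The coefficient of the background is conjugated because the singular part enters the
  potential through \<open>cnj\<close>.\<close>

definition outer_coeff :: "nat \<Rightarrow> nat \<Rightarrow> complex" where
  "outer_coeff k n = of_real (Q k n) * cnj (a n)"

lemma entire_inner: "k \<le> N \<Longrightarrow> entire_coeffs (inner_coeff k)"
  unfolding inner_coeff_def[abs_def]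
  by (intro entire_coeffs_exp_bounded entire_a a_0) (simp add: exp_bounded_modes)

lemma entire_outer: "k \<le> N \<Longrightarrow> entire_coeffs (outer_coeff k)"
  unfolding outer_coeff_def[abs_def]
  by (intro entire_coeffs_exp_bounded entire_coeffs_cnj entire_a)
    (simp_all add: exp_bounded_modes a_0)

text \<open>On the circle of radius \<open>\<rho>\<close> one has \<open>cnj ((1 / z)^n) = e^(i n \<theta>) / \<rho>^n\<close>, so the singular part of
  the potential is antiholomorphic.\<close>

definition decaying :: "nat \<Rightarrow> complex \<Rightarrow> complex" where
  "decaying k z = ps (outer_coeff k) (inverse z)"

definition layer_potential :: "nat \<Rightarrow> complex \<Rightarrow> complex" where
  "layer_potential k z = ps (inner_coeff k) z + cnj (decaying k z)"

text \<open>The radial derivative of \<open>layer_potential k\<close>, given by a formula that also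
  makes sense on the interfaces, where it supplies the one-sided limits.\<close>

definition layer_flux :: "nat \<Rightarrow> complex \<Rightarrow> complex" where
  "layer_flux k z = deriv (ps (inner_coeff k)) z * (z /\<^sub>R cmod z) + cnj (deriv (decaying k) z * (z /\<^sub>R cmod z))"

text \<open>Only the core contains the origin, and there the singular part vanishes.\<close>

definition potential_dom :: "nat \<Rightarrow> complex set" where
  "potential_dom k = (if k < N then - {0} else UNIV)"

lemma open_potential_dom: "open (potential_dom k)"
  by (simp add: potential_dom_def open_Compl)

lemma layer_subset_dom: "k \<le> N \<Longrightarrow> layer N r k \<subseteq> potential_dom k"
  using r_pos[of "k + 1"] by (auto simp: mem_layer_iff potential_dom_def)

lemma nonzero_in_dom: "z \<noteq> 0 \<Longrightarrow> z \<in> potential_dom k"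
  by (simp add: potential_dom_def)

lemma decaying_N: "decaying N z = 0"
  by (simp add: decaying_def outer_coeff_def ps_def)

lemma decaying_has_field_derivative:
  assumes "k \<le> N" "z \<noteq> 0"
  shows "(decaying k has_field_derivative - (ps (diffs (outer_coeff k)) (inverse z) * inverse z) / z) (at z)"
proof -
  have "(inverse has_field_derivative - (inverse z ^ Suc (Suc 0))) (at z)"
    using DERIV_inverse[OF assms(2)] by simp
  from DERIV_chain2[OF ps_has_field_derivative[OF entire_outer[OF assms(1)]] this]
  show ?thesis unfolding decaying_def[abs_def] by (simp add: divide_inverse mult.assoc)
qed

lemma decaying_holomorphic:
  assumes "k \<le> N"
  shows "decaying k holomorphic_on potential_dom k"
proof (cases "k < N")
  case True
  then show ?thesis
    unfolding holomorphic_on_open[OF open_potential_dom]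
    using decaying_has_field_derivative[OF assms] by (auto simp: potential_dom_def)
next
  case False
  then have "decaying k = (\<lambda>z. 0)" using assms decaying_N by auto
  then show ?thesis by simp
qed

text \<open>At the origin both sides use the default \<open>inverse 0 = 0\<close>, so the expansion
  covers the centre of the core.\<close>

lemma layer_potential_sums:
  assumes k: "k \<le> N"
  shows "(\<lambda>n. a n * (of_real (P k n) * z ^ n + of_real (Q k n) * inverse (cnj z) ^ n)) sums layer_potential k z"
proof -
  have "(\<lambda>n. cnj (outer_coeff k n * inverse z ^ n)) sums cnj (decaying k z)"
    unfolding decaying_def sums_cnj by (rule ps_sums[OF entire_outer[OF k]])
  from sums_add[OF ps_sums[OF entire_inner[OF k], of z] this]
  show ?thesis
    by (simp add: layer_potential_def inner_coeff_def outer_coeff_def algebra_simps)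
qed

text \<open>The factor \<open>cmod z\<close> turns the unit normal into \<open>z\<close>, after
  which \<open>ps_deriv_sums\<close> applies; the chain rule for \<open>inverse\<close> produces the
  minus sign of the singular terms.\<close>

lemma layer_flux_sums:
  assumes k: "k \<le> N" and z: "z \<noteq> 0"
  shows "(\<lambda>n. of_nat n * a n * (of_real (P k n) * z ^ n - of_real (Q k n) * inverse (cnj z) ^ n))
    sums (of_real (cmod z) * layer_flux k z)"
proof -
  have f: "of_real (cmod z) * layer_flux k z = ps (diffs (inner_coeff k)) z * z
      + cnj (- (ps (diffs (outer_coeff k)) (inverse z) * inverse z))"
    unfolding layer_flux_def DERIV_imp_deriv[OF ps_has_field_derivative[OF entire_inner[OF k]]]
      DERIV_imp_deriv[OF decaying_has_field_derivative[OF k z]]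
    using z by (simp add: scaleR_conv_of_real field_simps)
  have "(\<lambda>n. cnj (- (of_nat n * outer_coeff k n * inverse z ^ n))) sums
      cnj (- (ps (diffs (outer_coeff k)) (inverse z) * inverse z))"
    unfolding sums_cnj by (intro sums_minus ps_deriv_sums[OF entire_outer[OF k]])
  from sums_add[OF ps_deriv_sums[OF entire_inner[OF k], of z] this]
  show ?thesis
    unfolding f by (simp add: inner_coeff_def outer_coeff_def algebra_simps)
qed

text \<open>On a circle the regular and the singular term of a mode are proportional to the same
  power of \<open>z\<close>, so matching reduces to real coefficients.\<close>

lemma inverse_cnj_on_circle:
  assumes "cmod z = \<rho>"
  shows "inverse (cnj z) ^ n = z ^ n / of_real (\<rho> ^ (2 * n))"
proof -
  have "inverse (cnj z) = z / of_real (\<rho>\<^sup>2)"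
    unfolding assms[symmetric] complex_norm_square by (cases "z = 0") (auto simp: field_simps)
  then show ?thesis by (simp add: power_divide power_mult)
qed

text \<open>\<open>trace_match\<close> divided by the power of the radius makes the two series agree
  term by term.\<close>

lemma layer_potential_match:
  assumes k: "k \<in> {1..N}" and z: "cmod z = r k"
  shows "layer_potential (k - 1) z = layer_potential k z"
proof -
  have rk: "0 < r k" and k': "k - 1 < N" using k r_pos by auto
  have "P (k - 1) n + Q (k - 1) n / r k ^ (2 * n) = P k n + Q k n / r k ^ (2 * n)" for n
    using trace_match[OF weights_carrier[of n] gpm_weights[of _ n] k'] k rk by (simp add: field_simps)
  then have "of_real (P (k - 1) n) + of_real (Q (k - 1) n) / of_real (r k ^ (2 * n)) =
      (of_real (P k n) + of_real (Q k n) / of_real (r k ^ (2 * n)) :: complex)" for n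
    by (metis of_real_add of_real_divide)
  then have "(of_real (P (k - 1) n) + of_real (Q (k - 1) n) / of_real (r k ^ (2 * n))) * z ^ n =
      (of_real (P k n) + of_real (Q k n) / of_real (r k ^ (2 * n))) * z ^ n" for n
    by simp
  then have "of_real (P (k - 1) n) * z ^ n + of_real (Q (k - 1) n) * inverse (cnj z) ^ n =
      of_real (P k n) * z ^ n + of_real (Q k n) * inverse (cnj z) ^ n" for n
    unfolding inverse_cnj_on_circle[OF z] by (simp add: distrib_right)
  then show ?thesis
    using layer_potential_sums[OF less_imp_le[OF k'], of z] layer_potential_sums[of k z] k
    by (auto intro: sums_unique2)
qed

text \<open>The same termwise argument with \<open>flux_match\<close>; the common factor
  \<open>cmod z\<close> is cancelled at the end.\<close>

lemma layer_flux_match: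
  assumes k: "k \<in> {1..N}" and z: "cmod z = r k"
  shows "s (k - 1) *\<^sub>R layer_flux (k - 1) z = s k *\<^sub>R layer_flux k z"
proof -
  have rk: "0 < r k" and k': "k - 1 < N" using k r_pos by auto
  then have z0: "z \<noteq> 0" using z by auto
  have "s (k - 1) * (P (k - 1) n - Q (k - 1) n / r k ^ (2 * n)) = s k * (P k n - Q k n / r k ^ (2 * n))" for n
    using flux_match[OF weights_carrier[of n] gpm_weights[of _ n] k'] k rk by (simp add: field_simps)
  then have "of_real (s (k - 1)) * (of_real (P (k - 1) n) - of_real (Q (k - 1) n) / of_real (r k ^ (2 * n))) =
      (of_real (s k) * (of_real (P k n) - of_real (Q k n) / of_real (r k ^ (2 * n))) :: complex)" for n
    unfolding of_real_mult[symmetric] of_real_divide[symmetric] of_real_diff[symmetric] by (simp only: of_real_eq_iff)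
  then have "of_nat n * a n * z ^ n * (of_real (s (k - 1)) * (of_real (P (k - 1) n) - of_real (Q (k - 1) n) / of_real (r k ^ (2 * n)))) =
      of_nat n * a n * z ^ n * (of_real (s k) * (of_real (P k n) - of_real (Q k n) / of_real (r k ^ (2 * n))))" for n
    by simp
  then have *: "of_real (s (k - 1)) * (of_nat n * a n * (of_real (P (k - 1) n) * z ^ n - of_real (Q (k - 1) n) * inverse (cnj z) ^ n)) =
      of_real (s k) * (of_nat n * a n * (of_real (P k n) * z ^ n - of_real (Q k n) * inverse (cnj z) ^ n))" for n
    unfolding inverse_cnj_on_circle[OF z] by (simp add: algebra_simps)
  have "of_real (s (k - 1)) * (of_real (cmod z) * layer_flux (k - 1) z) =
      of_real (s k) * (of_real (cmod z) * layer_flux k z)"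
    by (rule sums_unique2[OF sums_mult[OF layer_flux_sums[OF less_imp_le[OF k'] z0],
            of "of_real (s (k - 1))", unfolded *] sums_mult[OF layer_flux_sums[OF _ z0]]])
      (use k in auto)
  then show ?thesis using z0 by (simp add: scaleR_conv_of_real)
qed

section \<open>The glued potential solves the transmission problem\<close>

definition solution :: "complex \<Rightarrow> complex" where
  "solution z = layer_potential (THE k. k \<le> N \<and> z \<in> layer N r k) z"

lemma solution_on_layer: "k \<le> N \<Longrightarrow> z \<in> layer N r k \<Longrightarrow> solution z = layer_potential k z"
  by (simp add: solution_def layer_THE)

lemma isCont_layer_potential:
  assumes "k \<le> N" "z \<noteq> 0"
  shows "isCont (layer_potential k) z"
  unfolding layer_potential_def[abs_def]
  using DERIV_isCont[OF ps_has_field_derivative[OF entire_inner[OF assms(1)]]]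
    DERIV_isCont[OF decaying_has_field_derivative[OF assms]]
  by (intro continuous_intros)

lemma isCont_layer_flux:
  assumes k: "k \<le> N" and z: "z \<noteq> 0"
  shows "isCont (layer_flux k) z"
proof -
  have "deriv (decaying k) holomorphic_on potential_dom k"
    by (intro holomorphic_deriv decaying_holomorphic open_potential_dom k)
  then have "isCont (deriv (decaying k)) z"
    using holomorphic_on_imp_continuous_on continuous_on_eq_continuous_at open_potential_dom
      nonzero_in_dom[OF z] by blast
  moreover have "deriv (ps (inner_coeff k)) holomorphic_on UNIV"
    by (intro holomorphic_deriv ps_holomorphic entire_inner k) simp
  then have "isCont (deriv (ps (inner_coeff k))) z"
    using holomorphic_on_imp_continuous_on continuous_on_eq_continuous_at open_UNIV by blast
  ultimately show ?thesis
    unfolding layer_flux_def[abs_def] using z by (intro continuous_intros) auto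
qed

lemma normal_deriv_solution:
  assumes k: "k \<le> N" and x: "x \<in> annulus k"
  shows "normal_deriv solution x = layer_flux k x"
  unfolding normal_deriv_def layer_flux_def
proof (rule holomorphic_plus_cnj_dir_deriv[OF open_annulus x])
  have "annulus k \<subseteq> potential_dom k"
    using annulus_subset_layer[OF k] layer_subset_dom[OF k] by blast
  then show "decaying k holomorphic_on annulus k"
    using decaying_holomorphic[OF k] holomorphic_on_subset by blast
  show "ps (inner_coeff k) holomorphic_on annulus k" by (intro ps_holomorphic entire_inner k)
  show "solution z = ps (inner_coeff k) z + cnj (decaying k z)" if "z \<in> annulus k" for z
    using that annulus_subset_layer[OF k] solution_on_layer[OF k] by (auto simp: layer_potential_def)
qed

lemma solution_harmonic:
  assumes k: "k \<le> N"
  shows "harmonic_on (interior (layer N r k)) solution"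
proof (rule holomorphic_plus_cnj_harmonic[OF open_interior, where f = "ps (inner_coeff k)" and g = "decaying k"])
  have "interior (layer N r k) \<subseteq> potential_dom k"
    using interior_subset layer_subset_dom[OF k] by blast
  then show "decaying k holomorphic_on interior (layer N r k)"
    using decaying_holomorphic[OF k] holomorphic_on_subset by blast
  show "ps (inner_coeff k) holomorphic_on interior (layer N r k)" by (intro ps_holomorphic entire_inner k)
  show "solution z = ps (inner_coeff k) z + cnj (decaying k z)" if "z \<in> interior (layer N r k)" for z
    using that interior_subset[of "layer N r k"] solution_on_layer[OF k] by (auto simp: layer_potential_def)
qed

text \<open>Outside the disk the difference is the conjugate of an entire function evaluated at
  \<open>inverse x\<close>. This function vanishes at 0, so its difference quotient there stays
  bounded.\<close>

lemma solution_decay: "(\<lambda>x. cmod (solution x - H x)) \<in> O[at_infinity](\<lambda>x. 1 / cmod x)"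
proof -
  let ?g = "ps (outer_coeff 0)"
  have g0: "?g 0 = 0"
    using powser_sums_zero[of "outer_coeff 0"] by (intro ps_eqI) (simp add: outer_coeff_def a_0)
  obtain D where "(?g has_field_derivative D) (at 0)"
    using ps_has_field_derivative[OF entire_outer] by blast
  then have "((\<lambda>h. ?g h / h) \<longlongrightarrow> D) (at 0)"
    unfolding DERIV_def using g0 by simp
  moreover have "filterlim (\<lambda>x. inverse x) (at 0) (at_infinity :: complex filter)"
    unfolding filterlim_inverse_at_iff by (rule filterlim_ident)
  ultimately have "((\<lambda>x. ?g (inverse x) / inverse x) \<longlongrightarrow> D) at_infinity"
    by (rule filterlim_compose)
  then have "eventually (\<lambda>x. cmod (?g (inverse x) / inverse x) < cmod D + 1) at_infinity"
    by (rule order_tendstoD(2)[OF tendsto_norm]) simp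
  \<comment> \<open>Places \<open>x\<close> in layer 0 and away from the origin.\<close>
  moreover have "eventually (\<lambda>x. max (r 1) 1 + 1 \<le> cmod x) (at_infinity :: complex filter)"
    unfolding eventually_at_infinity by blast
  ultimately have "eventually (\<lambda>x. norm (cmod (solution x - H x)) \<le> (cmod D + 1) * norm (1 / cmod x)) at_infinity"
  proof eventually_elim
    case (elim x)
    have "x \<in> layer N r 0" using elim by (auto simp: layer_def)
    then have "solution x = layer_potential 0 x" by (rule solution_on_layer[rotated]) simp
    moreover have "ps (inner_coeff 0) x = H x"
      by (rule ps_eqI) (simp add: inner_coeff_def H_sums)
    ultimately have "cmod (solution x - H x) = cmod (?g (inverse x))"
      by (simp add: layer_potential_def decaying_def)
    moreover have "0 < cmod x" using elim by linarith
    ultimately show ?case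
      using elim(1) by (simp add: norm_divide norm_mult norm_inverse field_simps)
  qed
  then show ?thesis by (rule bigoI)
qed

lemma solution_transmission: "transmission_solution N r s H solution"
  unfolding transmission_solution_def
proof (intro conjI allI ballI impI)
  fix k assume k: "k \<le> N"
  note har = solution_harmonic[OF k]
  show "C2_on (interior (layer N r k)) solution" using har by (simp add: harmonic_on_def)
  fix x assume x: "x \<in> interior (layer N r k)"
  have "div_coeff_grad (conductivity N r s) solution x =
      s k *\<^sub>R (dir_deriv 1 (dir_deriv 1 solution) x + dir_deriv \<i> (dir_deriv \<i> solution) x)"
    using har x interior_subset[of "layer N r k"] conductivity_layer[OF k]
    by (intro div_coeff_grad_const[OF open_interior x]) (auto simp: harmonic_on_def C2_on_def)
  then show "div_coeff_grad (conductivity N r s) solution x = 0"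
    using har x by (simp add: harmonic_on_def)
next
  fix k z assume k: "k \<in> {1..N}" and z: "cmod z = r k"
  have k': "k \<le> N" "k - 1 \<le> N" using k by auto
  have z0: "z \<noteq> 0" using z k r_pos[of k] by auto
  \<comment> \<open>Layers contain their outer circle, so the value at \<open>z\<close> comes from
    the inner side; the outer trace then needs \<open>layer_potential_match\<close>.\<close>
  have "z \<in> layer N r k" using k z r_decreasing[of k] by (auto simp: mem_layer_iff)
  then have uk: "solution z = layer_potential k z" using solution_on_layer k by auto
  note out = eventually_annulus_outside[OF k z]
  note inn = eventually_annulus_inside[OF k z]
  have lim: "(f \<longlongrightarrow> f z) (at z within S)" if "isCont f z" for f :: "complex \<Rightarrow> complex" and S
    using that continuous_at_imp_continuous_at_within continuous_within by blast
  have "eventually (\<lambda>x. layer_potential (k - 1) x = solution x) (at z within {x. r k < cmod x})"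
    using out by eventually_elim (use solution_on_layer[OF k'(2)] annulus_subset_layer[OF k'(2)] in auto)
  from Lim_transform_eventually[OF lim[OF isCont_layer_potential[OF k'(2) z0]] this]
  show "outer_limit (r k) solution z (solution z)"
    unfolding outer_limit_def uk layer_potential_match[OF k z] .
  have "eventually (\<lambda>x. layer_potential k x = solution x) (at z within {x. cmod x < r k})"
    using inn by eventually_elim (use solution_on_layer[OF k'(1)] annulus_subset_layer[OF k'(1)] in auto)
  from Lim_transform_eventually[OF lim[OF isCont_layer_potential[OF k'(1) z0]] this]
  show "inner_limit (r k) solution z (solution z)"
    unfolding inner_limit_def uk .
  show "\<exists>gp gm. outer_limit (r k) (normal_deriv solution) z gp \<and>
      inner_limit (r k) (normal_deriv solution) z gm \<and> s (k - 1) *\<^sub>R gp = s k *\<^sub>R gm"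
  proof (intro exI conjI)
    have "eventually (\<lambda>x. layer_flux (k - 1) x = normal_deriv solution x) (at z within {x. r k < cmod x})"
      using out by eventually_elim (simp add: normal_deriv_solution[OF k'(2)])
    then show "outer_limit (r k) (normal_deriv solution) z (layer_flux (k - 1) z)"
      unfolding outer_limit_def by (rule Lim_transform_eventually[OF lim[OF isCont_layer_flux[OF k'(2) z0]]])
    have "eventually (\<lambda>x. layer_flux k x = normal_deriv solution x) (at z within {x. cmod x < r k})"
      using inn by eventually_elim (simp add: normal_deriv_solution[OF k'(1)])
    then show "inner_limit (r k) (normal_deriv solution) z (layer_flux k z)"
      unfolding inner_limit_def by (rule Lim_transform_eventually[OF lim[OF isCont_layer_flux[OF k'(1) z0]]])
  qed (rule layer_flux_match[OF k z])
qed (rule solution_decay)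

text \<open>Subtracting the background series termwise lowers \<open>P l n\<close> by 1, which is
  the form of \<open>layer_coeff_eq\<close>. Since \<open>a 0 = 0\<close>, the sum may start at
  index 1.\<close>

lemma solution_series:
  assumes l: "l \<le> N" and z: "rcis \<rho> \<theta> \<in> layer N r l"
  shows "(\<lambda>m. a (Suc m) * cis (real (Suc m) * \<theta>) * of_real (layer_coeff N r s (Suc m) l \<rho>))
    sums (solution (rcis \<rho> \<theta>) - H (rcis \<rho> \<theta>))"
proof -
  let ?z = "rcis \<rho> \<theta>"
  have inv: "inverse (cnj ?z) = rcis (1 / \<rho>) \<theta>"
    using rcis_inverse[of \<rho> "- \<theta>"] by (simp add: rcis_def cis_cnj)
  have "(\<lambda>n. a n * (of_real (P l n) * ?z ^ n + of_real (Q l n) * inverse (cnj ?z) ^ n) - a n * ?z ^ n)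
      sums (solution ?z - H ?z)"
    unfolding solution_on_layer[OF l z] by (intro sums_diff layer_potential_sums H_sums l)
  moreover have "a n * (of_real (P l n) * ?z ^ n + of_real (Q l n) * inverse (cnj ?z) ^ n) - a n * ?z ^ n =
      a n * cis (real n * \<theta>) * of_real (layer_coeff N r s n l \<rho>)" for n
    unfolding inv DeMoivre2 layer_coeff_eq[OF l] by (simp add: rcis_def power_divide algebra_simps)
  ultimately have "(\<lambda>n. a n * cis (real n * \<theta>) * of_real (layer_coeff N r s n l \<rho>)) sums (solution ?z - H ?z)"
    by simp
  then show ?thesis
    using sums_Suc_iff[of "\<lambda>n. a n * cis (real n * \<theta>) * of_real (layer_coeff N r s n l \<rho>)"] by (simp add: a_0)
qed

end

section \<open>From the polar expansion of the background to its power series\<close>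

theorem theorem5p3:
  fixes N :: nat and r s :: "nat \<Rightarrow> real"
    and a :: "nat \<Rightarrow> complex" and H :: "complex \<Rightarrow> complex"
  assumes N: "N \<ge> 1"
    and r_decreasing: "\<And>k. 1 \<le> k \<Longrightarrow> k < N \<Longrightarrow> r (k + 1) < r k"
    and r_pos: "r N > 0"
    and s_pos: "\<And>k. k \<le> N \<Longrightarrow> s k > 0"
    and s_0: "s 0 = 1"
    and s_neq: "\<And>k. 1 \<le> k \<Longrightarrow> k \<le> N \<Longrightarrow> s k \<noteq> s (k - 1)"
    and H_harmonic: "harmonic_on UNIV H"
    and H_series: "\<And>\<rho> \<theta>. \<rho> \<ge> 0 \<Longrightarrow>
      (\<lambda>m. let n = Suc m in a n * of_real (\<rho> ^ n) * cis (real n * \<theta>)) sums H (rcis \<rho> \<theta>)"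
  shows "(\<forall>n\<ge>1. invertible_mat (gpm N r s n)) \<and>
    (\<exists>!u. transmission_solution N r s H u) \<and>
    (\<forall>u. transmission_solution N r s H u \<longrightarrow>
      (\<forall>l\<le>N. \<forall>\<rho> \<theta>. \<rho> \<ge> 0 \<longrightarrow> rcis \<rho> \<theta> \<in> layer N r l \<longrightarrow>
        (\<lambda>m. let n = Suc m in
           a n * cis (real n * \<theta>) * of_real (layer_coeff N r s n l \<rho>))
        sums (u (rcis \<rho> \<theta>) - H (rcis \<rho> \<theta>))))"
proof -
  \<comment> \<open>The given expansion starts at index 1; a zero coefficient at index 0 completes
    it to a power series.\<close>
  define a' where "a' n = (if n = 0 then 0 else a n)" for n
  interpret concentric_disk_background N r s a' H
  proof
    fix z :: complex
    have "(\<lambda>m. a (Suc m) * of_real (cmod z ^ Suc m) * cis (real (Suc m) * Arg z)) sums H (rcis (cmod z) (Arg z))"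
      using H_series[of "cmod z" "Arg z"] by (simp add: Let_def)
    moreover have "a (Suc m) * of_real (cmod z ^ Suc m) * cis (real (Suc m) * Arg z) = a' (Suc m) * z ^ Suc m" for m
    proof -
      have "z ^ Suc m = rcis (cmod z ^ Suc m) (real (Suc m) * Arg z)"
        unfolding DeMoivre2[symmetric] by (simp only: rcis_cmod_Arg)
      then show ?thesis by (simp only: a'_def rcis_def mult.assoc) simp
    qed
    ultimately have "(\<lambda>m. a' (Suc m) * z ^ Suc m) sums H z"
      by (simp only: rcis_cmod_Arg)
    then show "(\<lambda>n. a' n * z ^ n) sums H z"
      using sums_Suc_iff[of "\<lambda>n. a' n * z ^ n" "H z"] by (simp add: a'_def)
  qed (use assms in \<open>auto simp: a'_def\<close>)
  have a': "a' (Suc m) = a (Suc m)" for m by (simp add: a'_def)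
  have unique: "u = solution" if "transmission_solution N r s H u" for u
    using solution_unique[OF that solution_transmission] .
  show ?thesis
    unfolding Let_def
    using invertible_gpm solution_transmission unique solution_series[unfolded a'] by blast
qed

end
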